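(* There is a constant $c(n)$ such that the following holds. Let $x_0\in\mathbb R^{n+1}$, $t_0\in\mathbb R$, $\rho>0$, and let $u$ be a solution of the $\varepsilon$-parabolic Allen–Cahn equation on a neighbourhood of $\overline{B_\rho(x_0)}\times[t_0-\rho^2,t_0)$ with non-positive discrepancy and $|u|<1$. Let $f\ge0$ be a smooth function on the same set satisfying $$\partial_t f-\Delta f+\frac{\varepsilon\nabla_iu\nabla_ju}{\frac{\varepsilon|\nabla u|^2}{2}+\frac{W(u)}{\varepsilon}}\nabla_i\nabla_jf\le0 .$$ Then for every $t\in[t_0-\rho^2/4,t_0)$, $$\int_{B_{\rho/2}(x_0)}f^2\,\Phi_{x_0,t_0}(\cdot,t)\,d\mu_t\le\frac{c(n)}{\rho^{n+2}}\int_{t_0-\rho^2}^{t_0}\int_{B_\rho(x_0)}f^2\,d\mu_\tau\,d\tau .$$ In particular (taking $f=x_{n+1}$, $x_0=0$, $t_0=0$, $\rho=r$), $\int_{B_{r/2}}x_{n+1}^2\Phi_{0,0}\,d\mu_t\le c(n)r^{-n-2}\int_{-r^2}^0\int_{B_r}x_{n+1}^2\,d\mu_\tau\,d\tau$ for $t\in[-r^2/4,0)$.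
   Context: $W(u)=\frac{(1-u^2)^2}{2}$; the $\varepsilon$-parabolic Allen–Cahn equation is $\partial_t u=\Delta u-\varepsilon^{-2}W'(u)$. Non-positive discrepancy: $\frac{\varepsilon|\nabla u|^2}{2}-\frac{W(u)}{\varepsilon}\le0$. $d\mu_t=\big(\frac{\varepsilon|\nabla u(\cdot,t)|^2}{2}+\frac{W(u(\cdot,t))}{\varepsilon}\big)dx$. $\Phi_{x_0,t_0}(x,t)=(4\pi(t_0-t))^{-n/2}\exp\!\big(-\frac{|x-x_0|^2}{4(t_0-t)}\big)$ for $t<t_0$. $B_r(x)\subset\mathbb R^{n+1}$ Euclidean balls; summation over repeated indices $i,j=1,\dots,n+1$. *)

theory Defs
  imports "HOL-Analysis.Analysis"
begin

definition W :: "real \<Rightarrow> real" where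
  "W s = (1 - s\<^sup>2)\<^sup>2 / 2"

definition W' :: "real \<Rightarrow> real" where
  "W' s = 2 * s * (s\<^sup>2 - 1)"

definition pd :: "('a::real_normed_vector \<Rightarrow> real) \<Rightarrow> 'a \<Rightarrow> 'a \<Rightarrow> real" where
  "pd g v p = deriv (\<lambda>s. g (p + s *\<^sub>R v)) 0"

fun dirderiv :: "'a::real_normed_vector list \<Rightarrow> ('a \<Rightarrow> real) \<Rightarrow> 'a \<Rightarrow> real" where
  "dirderiv [] g = g"
| "dirderiv (v # vs) g = pd (dirderiv vs g) v"

text \<open>Smoothness (C-infinity) on an open set: all iterated directional derivatives
  exist (as genuine derivatives) and are continuous on the set.\<close>
definition smooth_on :: "'a::real_normed_vector set \<Rightarrow> ('a \<Rightarrow> real) \<Rightarrow> bool" where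
  "smooth_on U g \<longleftrightarrow>
     (\<forall>vs. continuous_on U (dirderiv vs g)) \<and>
     (\<forall>vs v. \<forall>p\<in>U. ((\<lambda>s. dirderiv vs g (p + s *\<^sub>R v)) has_real_derivative
                        dirderiv (v # vs) g p) (at 0))"

definition sd :: "('n::finite) \<Rightarrow> (real^'n \<Rightarrow> real \<Rightarrow> real) \<Rightarrow> real^'n \<Rightarrow> real \<Rightarrow> real" where
  "sd i u x t = pd (\<lambda>(y, s). u y s) (axis i 1, 0) (x, t)"

definition sdd :: "('n::finite) \<Rightarrow> 'n \<Rightarrow> (real^'n \<Rightarrow> real \<Rightarrow> real) \<Rightarrow> real^'n \<Rightarrow> real \<Rightarrow> real" where
  "sdd i j u x t = dirderiv [(axis i 1, 0), (axis j 1, 0)] (\<lambda>(y, s). u y s) (x, t)"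

definition td :: "(real^'n::finite \<Rightarrow> real \<Rightarrow> real) \<Rightarrow> real^'n \<Rightarrow> real \<Rightarrow> real" where
  "td u x t = pd (\<lambda>(y, s). u y s) (0, 1) (x, t)"

definition grad :: "(real^'n::finite \<Rightarrow> real \<Rightarrow> real) \<Rightarrow> real^'n \<Rightarrow> real \<Rightarrow> real^'n" where
  "grad u x t = (\<chi> i. sd i u x t)"

definition lap :: "(real^'n::finite \<Rightarrow> real \<Rightarrow> real) \<Rightarrow> real^'n \<Rightarrow> real \<Rightarrow> real" where
  "lap u x t = (\<Sum>i\<in>UNIV. sdd i i u x t)"

text \<open>Energy density of mu_t.\<close>
definition edens :: "real \<Rightarrow> (real^'n::finite \<Rightarrow> real \<Rightarrow> real) \<Rightarrow> real^'n \<Rightarrow> real \<Rightarrow> real" where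
  "edens \<epsilon> u x t = \<epsilon> * (norm (grad u x t))\<^sup>2 / 2 + W (u x t) / \<epsilon>"

text \<open>Backward heat kernel Phi_{x0,t0}(x,t) with exponent n/2 (n = ambient dim - 1).\<close>
definition Phi :: "nat \<Rightarrow> real^'n::finite \<Rightarrow> real \<Rightarrow> real^'n \<Rightarrow> real \<Rightarrow> real" where
  "Phi n x0 t0 x t = (4 * pi * (t0 - t)) powr (- real n / 2) * exp (- (norm (x - x0))\<^sup>2 / (4 * (t0 - t)))"

definition AC_sol :: "real \<Rightarrow> ((real^'n::finite) \<times> real) set \<Rightarrow> (real^'n \<Rightarrow> real \<Rightarrow> real) \<Rightarrow> bool" where
  "AC_sol \<epsilon> U u \<longleftrightarrow> open U \<and> smooth_on U (\<lambda>(x, t). u x t) \<and>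
     (\<forall>(x, t)\<in>U. td u x t = lap u x t - W' (u x t) / \<epsilon>\<^sup>2 \<and>
                  \<epsilon> * (norm (grad u x t))\<^sup>2 / 2 - W (u x t) / \<epsilon> \<le> 0 \<and>
                  \<bar>u x t\<bar> < 1)"

end

theory Submission
  imports Defs
begin

text \<open>
  The weighted energy \<open>\<integral> g \<psi> d\<mu>\<^sub>t\<close> with \<open>g = f\<^sup>2\<close> and \<open>\<psi> = \<Phi> \<eta>\<close>, where \<open>\<eta>\<close> is a spatial cutoff that
  equals \<open>1\<close> on the ball of radius \<open>\<rho>/2\<close>, is almost monotone. Up to a spatial divergence,
  its density has time derivative at most
  \<open>\<psi> (e (g\<^sub>t - \<Delta>g) + \<epsilon> u\<^sub>i u\<^sub>j g\<^sub>i\<^sub>j) + g (e (\<psi>\<^sub>t + \<Delta>\<psi>) - \<epsilon> u\<^sub>i u\<^sub>j (\<psi>\<^sub>i\<^sub>j - \<psi>\<^sub>i \<psi>\<^sub>j / \<psi>))\<close>.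
  The first bracket is nonpositive since \<open>g\<close> is a subsolution. In the second one the pure heat kernel part is
  \<open>\<Phi> \<eta> (\<epsilon> |\<nabla>u|\<^sup>2 - e) / (2 (t0 - t)) \<le> 0\<close> by the sign of the discrepancy, and the terms with derivatives of
  \<open>\<eta>\<close> live on an annulus, where the Gaussian is bounded by \<open>c \<rho>\<^sup>-\<^sup>n\<close> and the Gaussian
  over \<open>t0 - t\<close> by \<open>c \<rho>\<^sup>-\<^sup>n\<^sup>-\<^sup>2\<close>. Integrating from \<open>s\<close> to \<open>t\<close> and
  averaging over \<open>s\<close> in \<open>[t0 - \<rho>\<^sup>2, t0 - \<rho>\<^sup>2/4]\<close> gives the estimate.
\<close>

subsection \<open>Symmetry of second derivatives\<close>

text \<open>The kernel has exponent n/2 in dimension n + 1, so even where the cutoff is flat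
  \<open>\<psi>\<^sub>t + \<Delta>\<psi>\<close> is not zero but
  \<open>- \<Phi> / (2 (t0 - t))\<close>. The stress tensor contributes
  \<open>\<epsilon> |\<nabla>u|\<^sup>2 \<Phi> / (2 (t0 - t))\<close> against it, which is why the
  discrepancy decides the sign. The quotient of \<open>\<psi>\<^sub>i \<psi>\<^sub>j\<close> by
  \<open>\<psi>\<close> is what remains of \<open>- 2 \<epsilon> u\<^sub>t \<nabla>u \<cdot>
  \<nabla>\<psi> - \<epsilon> \<psi> u\<^sub>t\<^sup>2\<close> after completing the square in
  \<open>u\<^sub>t\<close>. As \<open>\<psi>\<close> vanishes near the boundary, the proof keeps
  \<open>u\<^sub>t\<close> in the identity and completes the square only after multiplying by the
  cutoff. The Hessian of u and the gradient of \<open>u\<^sub>t\<close> cancel, so neither has to be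
  estimated. Nothing controls the data as time approaches \<open>t0\<close>; the space-time integral
  may be infinite, hence the estimates in extended nonnegative reals.\<close>

lemma smooth_onD:
  assumes "smooth_on U g"
  shows "continuous_on U (dirderiv vs g)"
    and "p \<in> U \<Longrightarrow> ((\<lambda>s. dirderiv vs g (p + s *\<^sub>R v)) has_real_derivative dirderiv (v # vs) g p) (at 0)"
  using assms unfolding smooth_on_def by blast+

lemma smooth_on_line_derivative:
  assumes "smooth_on U g" "q + s *\<^sub>R v \<in> U"
  shows "((\<lambda>s. dirderiv vs g (q + s *\<^sub>R v)) has_real_derivative dirderiv (v # vs) g (q + s *\<^sub>R v)) (at s)"
proof -
  have "((\<lambda>r. dirderiv vs g ((q + s *\<^sub>R v) + r *\<^sub>R v)) has_real_derivative
      dirderiv (v # vs) g (q + s *\<^sub>R v)) (at 0)"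
    using assms by (rule smooth_onD)
  then show ?thesis
    using DERIV_shift[of "\<lambda>s. dirderiv vs g (q + s *\<^sub>R v)" "dirderiv (v # vs) g (q + s *\<^sub>R v)" 0 s]
    by (simp add: algebra_simps)
qed

text \<open>Mean value theorem twice: in direction \<open>v\<close> for the increment of
  \<open>g\<close> along \<open>w\<close>, then in direction \<open>w\<close>. The head of the list
  in \<open>dirderiv\<close> is the derivative taken last.\<close>

lemma second_difference:
  assumes sm: "smooth_on U g" and h: "h > 0"
    and U: "\<And>s r. 0 \<le> s \<Longrightarrow> s \<le> h \<Longrightarrow> 0 \<le> r \<Longrightarrow> r \<le> h \<Longrightarrow> p + s *\<^sub>R v + r *\<^sub>R w \<in> U"
  shows "\<exists>s r. 0 \<le> s \<and> s \<le> h \<and> 0 \<le> r \<and> r \<le> h \<and>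
    g (p + h *\<^sub>R v + h *\<^sub>R w) - g (p + h *\<^sub>R v) - g (p + h *\<^sub>R w) + g p
      = h\<^sup>2 * dirderiv [w, v] g (p + s *\<^sub>R v + r *\<^sub>R w)"
proof -
  let ?\<phi> = "\<lambda>s. g (p + h *\<^sub>R w + s *\<^sub>R v) - g (p + s *\<^sub>R v)"
  have d: "(?\<phi> has_real_derivative pd g v (p + h *\<^sub>R w + s *\<^sub>R v) - pd g v (p + s *\<^sub>R v)) (at s)"
    if "0 \<le> s" "s \<le> h" for s
    using smooth_on_line_derivative[OF sm, of "p + h *\<^sub>R w" s v "[]"]
      smooth_on_line_derivative[OF sm, of p s v "[]"] U[of s h] U[of s 0] that h
    by (auto intro!: derivative_intros simp: algebra_simps)
  obtain s where s: "0 < s" "s < h"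
    "?\<phi> h - ?\<phi> 0 = (h - 0) * (pd g v (p + h *\<^sub>R w + s *\<^sub>R v) - pd g v (p + s *\<^sub>R v))"
    using MVT2[OF h d] by auto
  have d2: "((\<lambda>r. pd g v (p + s *\<^sub>R v + r *\<^sub>R w)) has_real_derivative
      dirderiv [w, v] g (p + s *\<^sub>R v + r *\<^sub>R w)) (at r)" if "0 \<le> r" "r \<le> h" for r
    using smooth_on_line_derivative[OF sm, of "p + s *\<^sub>R v" r w "[v]"] U[of s r] that s by auto
  obtain r where r: "0 < r" "r < h"
    "pd g v (p + s *\<^sub>R v + h *\<^sub>R w) - pd g v (p + s *\<^sub>R v + 0 *\<^sub>R w)
      = (h - 0) * dirderiv [w, v] g (p + s *\<^sub>R v + r *\<^sub>R w)"
    using MVT2[OF h d2] by auto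
  have "?\<phi> h - ?\<phi> 0 = h\<^sup>2 * dirderiv [w, v] g (p + s *\<^sub>R v + r *\<^sub>R w)"
    using s(3) r(3) by (simp add: algebra_simps power2_eq_square)
  then show ?thesis
    using s r by (intro exI[of _ s] exI[of _ r]) (simp add: algebra_simps)
qed

text \<open>Schwarz's theorem, since \<open>smooth_on\<close> does not build in any symmetry. The
  second difference is symmetric in \<open>v\<close> and \<open>w\<close>, so the two mixed
  derivatives agree at points near \<open>p\<close>; with \<open>e\<close> half the supposed gap at
  \<open>p\<close>, continuity makes this impossible.\<close>

lemma dirderiv_commute:
  assumes sm: "smooth_on U g" and "open U" "p \<in> U"
  shows "dirderiv [v, w] g p = dirderiv [w, v] g p"
proof (rule ccontr)
  assume ne: "dirderiv [v, w] g p \<noteq> dirderiv [w, v] g p"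
  define e where "e = \<bar>dirderiv [v, w] g p - dirderiv [w, v] g p\<bar> / 2"
  have e: "e > 0" using ne by (simp add: e_def)
  have ev: "\<forall>\<^sub>F y in nhds p. y \<in> U \<and> \<bar>dirderiv [a, b] g y - dirderiv [a, b] g p\<bar> < e" for a b
  proof -
    have "isCont (dirderiv [a, b] g) p"
      using smooth_onD(1)[OF sm] assms(2,3) by (simp only: continuous_on_eq_continuous_at)
    then have "\<forall>\<^sub>F y in nhds p. dist (dirderiv [a, b] g y) (dirderiv [a, b] g p) < e"
      using e by (intro tendstoD) (simp_all only: isCont_def tendsto_at_iff_tendsto_nhds)
    moreover have "\<forall>\<^sub>F y in nhds p. y \<in> U"
      using assms(2,3) by (rule eventually_nhds_in_open)
    ultimately show ?thesis by eventually_elim (simp add: dist_real_def)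
  qed
  from eventually_conj[OF ev[of v w] ev[of w v]] obtain d where d: "d > 0"
    "\<And>y. dist y p < d \<Longrightarrow> y \<in> U \<and> \<bar>dirderiv [v, w] g y - dirderiv [v, w] g p\<bar> < e \<and>
       \<bar>dirderiv [w, v] g y - dirderiv [w, v] g p\<bar> < e"
    unfolding eventually_nhds_metric by blast
  define M where "M = norm v + norm w + 1"
  have M: "M > 0" by (simp add: M_def add_nonneg_pos)
  \<comment> \<open>With this side length the whole parallelogram stays within distance
    \<open>d\<close> of \<open>p\<close>; the summand 1 in \<open>M\<close> covers the case that
    both directions are zero.\<close>
  define h where "h = d / (2 * M)"
  have h: "h > 0" using d(1) M by (simp add: h_def)
  have near: "dist (p + s *\<^sub>R v + r *\<^sub>R w) p < d" if "0 \<le> s" "s \<le> h" "0 \<le> r" "r \<le> h" for s r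
  proof -
    have "norm (s *\<^sub>R v + r *\<^sub>R w) \<le> s * norm v + r * norm w"
      using norm_triangle_ineq[of "s *\<^sub>R v" "r *\<^sub>R w"] that by simp
    also have "\<dots> \<le> h * norm v + h * norm w"
      using that by (intro add_mono mult_right_mono) auto
    also have "\<dots> < 2 * (h * M)"
      using h by (simp add: M_def algebra_simps) (smt (verit) mult_nonneg_nonneg norm_ge_zero)
    also have "\<dots> = d" using M by (simp add: h_def)
    finally show ?thesis by (simp add: dist_norm algebra_simps)
  qed
  obtain s r where 1: "0 \<le> s" "s \<le> h" "0 \<le> r" "r \<le> h"
    "g (p + h *\<^sub>R v + h *\<^sub>R w) - g (p + h *\<^sub>R v) - g (p + h *\<^sub>R w) + g p
      = h\<^sup>2 * dirderiv [w, v] g (p + s *\<^sub>R v + r *\<^sub>R w)"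
    using second_difference[OF sm h, of p v w] near d(2) by blast
  have "p + s *\<^sub>R w + r *\<^sub>R v \<in> U" if "0 \<le> s" "s \<le> h" "0 \<le> r" "r \<le> h" for s r
    using near[of r s] that d(2) by (metis add.assoc add.commute)
  then obtain s' r' where 2: "0 \<le> s'" "s' \<le> h" "0 \<le> r'" "r' \<le> h"
    "g (p + h *\<^sub>R w + h *\<^sub>R v) - g (p + h *\<^sub>R w) - g (p + h *\<^sub>R v) + g p
      = h\<^sup>2 * dirderiv [v, w] g (p + s' *\<^sub>R w + r' *\<^sub>R v)"
    using second_difference[OF sm h, of p w v] by blast
  have "h\<^sup>2 * dirderiv [w, v] g (p + s *\<^sub>R v + r *\<^sub>R w) = h\<^sup>2 * dirderiv [v, w] g (p + r' *\<^sub>R v + s' *\<^sub>R w)"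
    using 1(5) 2(5) by (simp add: algebra_simps)
  then have "dirderiv [w, v] g (p + s *\<^sub>R v + r *\<^sub>R w) = dirderiv [v, w] g (p + r' *\<^sub>R v + s' *\<^sub>R w)"
    using h by simp
  moreover note d(2)[OF near[OF 1(1-4)]] d(2)[OF near[OF 2(3,4) 2(1,2)]]
  ultimately show False unfolding e_def by (smt (verit) field_sum_of_halves)
qed

subsection \<open>Integrals of compactly supported derivatives\<close>

lemma lborel_integral_translate:
  fixes F :: "'a::euclidean_space \<Rightarrow> real"
  assumes "F \<in> borel_measurable borel"
  shows "(\<integral>x. F (x + c) \<partial>lborel) = (\<integral>x. F x \<partial>lborel)"
proof -
  have "(\<integral>x. F x \<partial>lborel) = (\<integral>x. F x \<partial>(distr lborel borel ((+) c)))"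
    by (simp add: lborel_distr_plus)
  also have "\<dots> = (\<integral>x. F (c + x) \<partial>lborel)"
    using assms by (subst integral_distr) auto
  finally show ?thesis by (simp add: add.commute)
qed

lemma integrable_continuous_compact_support:
  fixes F :: "'a::euclidean_space \<Rightarrow> real"
  assumes "continuous_on UNIV F" "compact K" "\<And>x. x \<notin> K \<Longrightarrow> F x = 0"
  shows "integrable lborel F"
proof -
  have "integrable lborel (\<lambda>x. indicator K x *\<^sub>R F x)"
    using assms by (intro borel_integrable_compact) (auto intro: continuous_on_subset)
  also have "(\<lambda>x. indicator K x *\<^sub>R F x) = F"
    using assms(3) by (auto simp: indicator_def fun_eq_iff)
  finally show ?thesis .
qed

text \<open>Average the integral of \<open>G\<close> over its translates by
  \<open>s *\<^sub>R v\<close> with s in [0, 1] and exchange the integrals. The inner integral over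
  s becomes \<open>F (x + v) - F x\<close>, which integrates to 0 by translation invariance. No
  slicing into coordinates is required.\<close>

lemma integral_directional_derivative_eq_0:
  fixes F G :: "'a::euclidean_space \<Rightarrow> real"
  assumes der: "\<And>x. ((\<lambda>s. F (x + s *\<^sub>R v)) has_real_derivative G x) (at 0)"
    and contF: "continuous_on UNIV F" and contG: "continuous_on UNIV G" and K: "compact K"
    and F0: "\<And>x. x \<notin> K \<Longrightarrow> F x = 0" and G0: "\<And>x. x \<notin> K \<Longrightarrow> G x = 0"
  shows "(\<integral>x. G x \<partial>lborel) = 0"
proof -
  let ?f = "\<lambda>(x::'a) (s::real). indicator {0..1} s *\<^sub>R G (x + s *\<^sub>R v)"
  \<comment> \<open>A sheared copy of \<open>K \<times> {0..1}\<close>: off this compact set the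
    integrand on the product space is 0, which gives integrability for Fubini.\<close>
  let ?C = "(\<lambda>(y, s). (y - s *\<^sub>R v, s)) ` (K \<times> {0..1::real})"
  have "compact ?C"
    using K by (intro compact_continuous_image compact_Times) (auto intro!: continuous_intros simp: case_prod_unfold)
  moreover have cG: "continuous_on S (\<lambda>z. G (fst z + snd z *\<^sub>R v))" for S
    by (intro continuous_on_compose2[OF contG] continuous_intros) auto
  ultimately have "integrable lborel (\<lambda>z. indicator ?C z *\<^sub>R G (fst z + snd z *\<^sub>R v))"
    by (intro borel_integrable_compact)
  also have "(\<lambda>z. indicator ?C z *\<^sub>R G (fst z + snd z *\<^sub>R v)) = case_prod ?f"
  proof
    fix z :: "'a \<times> real"
    obtain x s where z: "z = (x, s)" by (cases z)
    have "z \<in> ?C \<longleftrightarrow> x + s *\<^sub>R v \<in> K \<and> 0 \<le> s \<and> s \<le> 1"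
      by (auto simp: z image_iff intro: bexI[of _ "x + s *\<^sub>R v"])
    then show "indicator ?C z *\<^sub>R G (fst z + snd z *\<^sub>R v) = case_prod ?f z"
      using G0[of "x + s *\<^sub>R v"] by (auto simp: z indicator_def)
  qed
  finally have "integrable (lborel \<Otimes>\<^sub>M lborel) (case_prod ?f)"
    by (simp add: lborel_prod)
  then have fub: "(\<integral>s. (\<integral>x. ?f x s \<partial>lborel) \<partial>lborel) = (\<integral>x. (\<integral>s. ?f x s \<partial>lborel) \<partial>lborel)"
    by (rule lborel_pair.Fubini_integral)
  have Gm: "G \<in> borel_measurable borel" and Fm: "F \<in> borel_measurable borel"
    using contF contG by (auto intro: borel_measurable_continuous_onI)
  have "(\<integral>x. ?f x s \<partial>lborel) = indicator {0..1} s * (\<integral>x. G x \<partial>lborel)" for s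
    using lborel_integral_translate[OF Gm] by simp
  then have "(\<integral>s. (\<integral>x. ?f x s \<partial>lborel) \<partial>lborel) = (\<integral>x. G x \<partial>lborel)"
    by (simp only:) simp
  moreover have "(\<integral>s. ?f x s \<partial>lborel) = F (x + v) - F x" for x
  proof -
    have "((\<lambda>s. F (x + s *\<^sub>R v)) has_real_derivative G (x + s *\<^sub>R v)) (at s)" for s
      using der[of "x + s *\<^sub>R v"] DERIV_shift[of "\<lambda>s. F (x + s *\<^sub>R v)" "G (x + s *\<^sub>R v)" 0 s]
      by (simp add: algebra_simps)
    moreover have "continuous_on {0..1} (\<lambda>s. G (x + s *\<^sub>R v))"
      by (intro continuous_on_compose2[OF contG] continuous_intros) auto
    ultimately show ?thesis
      using integral_FTC_Icc[of 0 1 "\<lambda>s. F (x + s *\<^sub>R v)" "\<lambda>s. G (x + s *\<^sub>R v)"]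
      by (auto simp: has_real_derivative_iff_has_vector_derivative intro: has_vector_derivative_at_within)
  qed
  moreover have "(\<integral>x. F (x + v) - F x \<partial>lborel) = 0"
  proof -
    have i: "integrable lborel F"
      using contF K F0 by (rule integrable_continuous_compact_support)
    have "integrable lborel (\<lambda>x. F (x + v))"
    proof (rule integrable_continuous_compact_support)
      show "continuous_on UNIV (\<lambda>x. F (x + v))"
        by (intro continuous_on_compose2[OF contF] continuous_intros) auto
      show "compact ((\<lambda>y. y - v) ` K)"
        using K by (intro compact_continuous_image continuous_intros)
      show "F (x + v) = 0" if "x \<notin> (\<lambda>y. y - v) ` K" for x
        using that F0[of "x + v"] by (force simp: image_iff)
    qed
    then show ?thesis
      using i lborel_integral_translate[OF Fm] by simp
  qed
  ultimately show ?thesis using fub by simp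
qed

text \<open>The flux is controlled only on a time slice of \<open>U\<close>, whereas the divergence
  lemma needs functions on the whole space. The open sets \<open>V\<close> and \<open>- K\<close>
  cover the space, and the extension is continuous on each.\<close>

lemma continuous_on_zero_extension:
  fixes f :: "'a::topological_space \<Rightarrow> real"
  assumes "open V" "closed K" "K \<subseteq> V" "continuous_on V f" "\<And>x. x \<in> V - K \<Longrightarrow> f x = 0"
  shows "continuous_on UNIV (\<lambda>x. indicator K x * f x)"
proof -
  have "continuous_on V (\<lambda>x. indicator K x * f x)"
    using assms(4) by (rule continuous_on_eq) (use assms(5) in \<open>auto simp: indicator_def\<close>)
  moreover have "continuous_on (- K) (\<lambda>x. indicator K x * f x)"
    by (rule continuous_on_eq[of _ "\<lambda>_. 0"]) auto
  ultimately have "continuous_on (V \<union> - K) (\<lambda>x. indicator K x * f x)"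
    using assms by (intro continuous_on_open_Un) auto
  moreover have "V \<union> - K = UNIV" using assms by auto
  ultimately show ?thesis by simp
qed

lemma line_in_open_eventually:
  fixes x v :: "'a::real_normed_vector"
  assumes "open V" "x \<in> V"
  shows "\<forall>\<^sub>F s in nhds 0. x + s *\<^sub>R v \<in> V"
proof -
  have "((\<lambda>s. x + s *\<^sub>R v) \<longlongrightarrow> x + 0 *\<^sub>R v) (nhds 0)"
    by (intro tendsto_intros filterlim_ident)
  then show ?thesis using assms by (auto intro: topological_tendstoD)
qed

lemma directional_derivative_zero_extension:
  fixes f f' :: "'a::real_normed_vector \<Rightarrow> real"
  assumes "open V" "closed K" "K \<subseteq> V"
    and der: "\<And>x. x \<in> V \<Longrightarrow> ((\<lambda>s. f (x + s *\<^sub>R v)) has_real_derivative f' x) (at 0)"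
    and 0: "\<And>x. x \<in> V - K \<Longrightarrow> f x = 0" "\<And>x. x \<in> V - K \<Longrightarrow> f' x = 0"
  shows "((\<lambda>s. indicator K (x + s *\<^sub>R v) * f (x + s *\<^sub>R v)) has_real_derivative indicator K x * f' x) (at 0)"
proof (cases "x \<in> V")
  case True
  have "\<forall>\<^sub>F s in nhds 0. indicator K (x + s *\<^sub>R v) * f (x + s *\<^sub>R v) = f (x + s *\<^sub>R v)"
    using line_in_open_eventually[OF assms(1) True, of v]
    by eventually_elim (use 0 in \<open>auto simp: indicator_def\<close>)
  moreover have "indicator K x * f' x = f' x"
    using 0(2)[of x] True by (auto simp: indicator_def)
  ultimately show ?thesis
    using der[OF True] by (subst DERIV_cong_ev[OF refl])
next
  case False
  then have "\<forall>\<^sub>F s in nhds 0. x + s *\<^sub>R v \<in> - K"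
    using assms by (intro line_in_open_eventually) auto
  then have "\<forall>\<^sub>F s in nhds 0. indicator K (x + s *\<^sub>R v) * f (x + s *\<^sub>R v) = 0"
    by eventually_elim auto
  moreover have "indicator K x * f' x = 0" using False assms(3) by (auto simp: indicator_def)
  ultimately show ?thesis
    using DERIV_const[of 0 "at 0"] by (subst DERIV_cong_ev[OF refl])
qed

text \<open>The fundamental theorem of calculus in time and Fubini turn a bound on the rate into a
  bound on the increment. \<open>K\<close> and \<open>S\<close> are separate because the energy is
  integrated over a compact ball, while the final estimate is stated on the open ball.\<close>

lemma integral_increment_le:
  fixes E D B :: "'a::euclidean_space \<Rightarrow> real \<Rightarrow> real"
  assumes K: "compact K" and S: "S \<in> sets borel" "S \<subseteq> K" and st: "s \<le> t"
    and der: "\<And>x \<tau>. x \<in> K \<Longrightarrow> s \<le> \<tau> \<Longrightarrow> \<tau> \<le> t \<Longrightarrow> (E x has_real_derivative D x \<tau>) (at \<tau>)"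
    and contE: "continuous_on (K \<times> {s..t}) (case_prod E)"
    and contD: "continuous_on (K \<times> {s..t}) (case_prod D)"
    and contB: "continuous_on (K \<times> {s..t}) (case_prod B)"
    and B0: "\<And>x \<tau>. x \<in> K \<Longrightarrow> s \<le> \<tau> \<Longrightarrow> \<tau> \<le> t \<Longrightarrow> 0 \<le> B x \<tau>"
    and le: "\<And>\<tau>. s \<le> \<tau> \<Longrightarrow> \<tau> \<le> t \<Longrightarrow>
      (\<integral>x. indicator K x * D x \<tau> \<partial>lborel) \<le> L * (\<integral>x. indicator S x * B x \<tau> \<partial>lborel)"
    and L: "0 \<le> L"
  shows "ennreal (\<integral>x. indicator K x * E x t \<partial>lborel) \<le> ennreal (\<integral>x. indicator K x * E x s \<partial>lborel)
    + ennreal L * (\<integral>\<^sup>+\<tau>. (\<integral>\<^sup>+x. ennreal (B x \<tau>) * indicator S x \<partial>lborel) * indicator {s..t} \<tau> \<partial>lborel)"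
proof -
  have KT: "compact (K \<times> {s..t})" using K by (intro compact_Times) auto
  let ?d = "\<lambda>x \<tau>. indicator (K \<times> {s..t}) (x, \<tau>) *\<^sub>R D x \<tau>"
  let ?b = "\<lambda>x \<tau>. indicator (S \<times> {s..t}) (x, \<tau>) *\<^sub>R B x \<tau>"
  have slice: "continuous_on K (\<lambda>x. H x \<tau>)"
    if "continuous_on (K \<times> {s..t}) (case_prod H)" "s \<le> \<tau>" "\<tau> \<le> t" for H :: "'a \<Rightarrow> real \<Rightarrow> real" and \<tau>
    using that by (intro continuous_on_compose2[OF that(1), where f="\<lambda>x. (x, \<tau>)", simplified]) (auto intro!: continuous_intros)
  have islice: "integrable lborel (\<lambda>x. indicator K x * H x \<tau>)"
    if "continuous_on (K \<times> {s..t}) (case_prod H)" "s \<le> \<tau>" "\<tau> \<le> t" for H :: "'a \<Rightarrow> real \<Rightarrow> real" and \<tau>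
    using borel_integrable_compact[OF K slice[OF that]] by simp
  have iD: "integrable (lborel \<Otimes>\<^sub>M lborel) (case_prod ?d)"
    using borel_integrable_compact[OF KT contD] by (simp add: lborel_prod split_beta')
  have "set_integrable lborel (K \<times> {s..t}) (case_prod B)"
    using borel_integrable_compact[OF KT contB] by (simp add: set_integrable_def)
  then have "set_integrable lborel (S \<times> {s..t}) (case_prod B)"
    using S by (rule_tac set_integrable_subset) (auto intro: borel_Times)
  then have iB: "integrable (lborel \<Otimes>\<^sub>M lborel) (case_prod ?b)"
    by (simp add: set_integrable_def lborel_prod split_beta')
  have ftc: "(\<integral>\<tau>. ?d x \<tau> \<partial>lborel) = indicator K x * E x t - indicator K x * E x s" for x
  proof (cases "x \<in> K")
    case True
    have "continuous_on {s..t} (D x)"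
      using True by (intro continuous_on_compose2[OF contD, where f="\<lambda>\<tau>. (x, \<tau>)", simplified]) (auto intro!: continuous_intros)
    then have "(\<integral>\<tau>. indicator {s..t} \<tau> *\<^sub>R D x \<tau> \<partial>lborel) = E x t - E x s"
      using st der[OF True]
      by (intro integral_FTC_Icc)
        (auto simp: has_real_derivative_iff_has_vector_derivative intro: has_vector_derivative_at_within)
    then show ?thesis using True by (simp add: indicator_times)
  qed (simp add: indicator_times)
  have "(\<integral>x. indicator K x * E x t \<partial>lborel) - (\<integral>x. indicator K x * E x s \<partial>lborel)
      = (\<integral>x. (\<integral>\<tau>. ?d x \<tau> \<partial>lborel) \<partial>lborel)"
    using islice[OF contE] st unfolding ftc by simp
  also have "\<dots> = (\<integral>\<tau>. (\<integral>x. ?d x \<tau> \<partial>lborel) \<partial>lborel)"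
    using lborel_pair.Fubini_integral[OF iD] by simp
  also have "\<dots> \<le> (\<integral>\<tau>. L * (\<integral>x. ?b x \<tau> \<partial>lborel) \<partial>lborel)"
  proof (rule integral_mono)
    show "integrable lborel (\<lambda>\<tau>. \<integral>x. ?d x \<tau> \<partial>lborel)"
      using lborel_pair.integrable_snd[OF iD] by simp
    show "integrable lborel (\<lambda>\<tau>. L * (\<integral>x. ?b x \<tau> \<partial>lborel))"
      using lborel_pair.integrable_snd[OF iB] by simp
    show "(\<integral>x. ?d x \<tau> \<partial>lborel) \<le> L * (\<integral>x. ?b x \<tau> \<partial>lborel)" for \<tau>
      using le[of \<tau>] by (cases "\<tau> \<in> {s..t}") (simp_all add: indicator_times)
  qed
  finally have main: "(\<integral>x. indicator K x * E x t \<partial>lborel)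
    \<le> (\<integral>x. indicator K x * E x s \<partial>lborel) + L * (\<integral>\<tau>. (\<integral>x. ?b x \<tau> \<partial>lborel) \<partial>lborel)" (is "_ \<le> _ + L * ?J") by simp
  have b0: "0 \<le> ?b x \<tau>" for x \<tau>
    using B0[of x \<tau>] S by (auto simp: indicator_def)
  have inner: "(\<integral>\<^sup>+x. ennreal (?b x \<tau>) \<partial>lborel) = ennreal (\<integral>x. ?b x \<tau> \<partial>lborel)" for \<tau>
  proof (rule nn_integral_eq_integral)
    show "integrable lborel (\<lambda>x. ?b x \<tau>)"
    proof (cases "\<tau> \<in> {s..t}")
      case True
      have "set_integrable lborel K (\<lambda>x. B x \<tau>)"
        using islice[OF contB] True by (simp add: set_integrable_def)
      then have "set_integrable lborel S (\<lambda>x. B x \<tau>)"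
        using S by (rule_tac set_integrable_subset) auto
      then show ?thesis using True by (simp add: set_integrable_def indicator_times)
    qed (simp add: indicator_times)
  qed (use b0 in auto)
  have "ennreal ?J = (\<integral>\<^sup>+\<tau>. ennreal (\<integral>x. ?b x \<tau> \<partial>lborel) \<partial>lborel)"
    using lborel_pair.integrable_snd[OF iB] b0
    by (intro nn_integral_eq_integral[symmetric]) (auto intro!: integral_nonneg_AE)
  also have "\<dots> = (\<integral>\<^sup>+\<tau>. (\<integral>\<^sup>+x. ennreal (B x \<tau>) * indicator S x \<partial>lborel) * indicator {s..t} \<tau> \<partial>lborel)"
    unfolding inner[symmetric]
    by (intro nn_integral_cong) (auto simp: indicator_times indicator_def intro!: nn_integral_cong)
  finally have J: "ennreal ?J = \<dots>" .
  have J0: "?J \<ge> 0" using b0 by (auto intro!: integral_nonneg_AE)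
  then have "L * ?J \<ge> 0" using L by simp
  then have "ennreal (\<integral>x. indicator K x * E x t \<partial>lborel) \<le> ennreal (\<integral>x. indicator K x * E x s \<partial>lborel) + ennreal (L * ?J)"
    using main by (cases "0 \<le> (\<integral>x. indicator K x * E x s \<partial>lborel)")
      (auto simp: ennreal_plus[symmetric] ennreal_neg simp del: ennreal_plus intro!: ennreal_leI)
  then show ?thesis using L J0 by (simp only: ennreal_mult J)
qed

subsection \<open>Cutoff and Gaussian bounds\<close>

text \<open>Truncated powers allow a cutoff that is piecewise polynomial and still twice
  continuously differentiable. At 0 the difference quotient is the continuous function
  \<open>(max 0 z) ^ (n + 1)\<close>, so Caratheodory's criterion applies.\<close>

lemma has_real_derivative_pos_part_power:
  "((\<lambda>y::real. (max 0 y) ^ (n + 2)) has_real_derivative real (n + 2) * (max 0 y) ^ (n + 1)) (at y)"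
proof -
  consider "y < 0" | "y > 0" | "y = 0" by linarith
  then show ?thesis
  proof cases
    case 1
    have "\<forall>\<^sub>F x in nhds y. (max 0 x) ^ (n + 2) = (0::real)"
      using eventually_nhds_in_open[of "{..<0}" y] 1 by (auto elim!: eventually_mono)
    then show ?thesis using 1 by (subst DERIV_cong_ev[OF refl _ refl, where g="\<lambda>_. 0"]) auto
  next
    case 2
    have ev: "\<forall>\<^sub>F x in nhds y. (max 0 x) ^ (n + 2) = x ^ (n + 2)"
      using eventually_nhds_in_open[of "{0<..}" y] 2 by (auto elim!: eventually_mono)
    have "((\<lambda>x. x ^ (n + 2)) has_real_derivative real (n + 2) * (max 0 y) ^ (n + 1)) (at y)"
      using 2 DERIV_pow[of "n + 2" y] by simp
    then show ?thesis by (subst DERIV_cong_ev[OF refl ev refl])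
  next
    case 3
    have "isCont (\<lambda>z::real. (max 0 z) ^ (n + 1)) 0" by (intro continuous_intros)
    moreover have "(max 0 z) ^ (n + 2) = (max 0 z) ^ (n + 1) * z" for z :: real
      by (auto simp: max_def)
    ultimately show ?thesis
      unfolding 3 CARAT_DERIV by (intro exI[of _ "\<lambda>z. (max 0 z) ^ (n + 1)"]) auto
  qed
qed

text \<open>The argument stands for \<open>|x - x0|\<^sup>2 / \<rho>\<^sup>2\<close>, hence the
  thresholds 1/4 and 1 for the radii \<open>\<rho> / 2\<close> and \<open>\<rho>\<close>. The
  squared distance is a polynomial, so the centre needs no special treatment.\<close>

definition is_cutoff :: "real \<Rightarrow> (real \<Rightarrow> real) \<Rightarrow> (real \<Rightarrow> real) \<Rightarrow> (real \<Rightarrow> real) \<Rightarrow> bool" where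
  "is_cutoff K h h1 h2 \<longleftrightarrow>
    (\<forall>s. (h has_real_derivative h1 s) (at s)) \<and> (\<forall>s. (h1 has_real_derivative h2 s) (at s)) \<and>
    continuous_on UNIV h2 \<and>
    (\<forall>s\<le>1/4. h s = 1 \<and> h1 s = 0 \<and> h2 s = 0) \<and> (\<forall>s\<ge>1. h s = 0 \<and> h1 s = 0 \<and> h2 s = 0) \<and>
    (\<forall>s. 0 \<le> h s \<and> h s \<le> 1 \<and> \<bar>h1 s\<bar> \<le> K \<and> \<bar>h2 s\<bar> \<le> K \<and> (h1 s)\<^sup>2 \<le> K * h s)"

text \<open>The bound \<open>h1\<^sup>2 \<le> K h\<close> controls \<open>|\<nabla>\<psi>|\<^sup>2 / \<psi>\<close> where the cutoff tends to zero; it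
  holds because \<open>h\<close> vanishes to third order at \<open>1\<close>.\<close>

lemma cutoff_exists: "\<exists>h h1 h2. is_cutoff 144 h h1 h2"
proof -
  \<comment> \<open>\<open>b\<close> maps [1/4, 1] affinely onto [0, 1], and \<open>h\<close> is the
    positive part of \<open>1 - b ^ 3\<close>, cubed. The inner cube gives two continuous
    derivatives at 1/4, the outer one at 1. The constant 144 is the square of the 12 in
    \<open>h1\<close>, because \<open>(h1 s)\<^sup>2 = 144 * h s * a s * b s ^ 4\<close>.\<close>
  define b where "b s = max 0 ((s - 1/4) * (4/3))" for s :: real
  define a where "a s = max 0 (1 - b s ^ 3)" for s :: real
  define h where "h s = a s ^ 3" for s
  define h1 where "h1 s = - 12 * a s ^ 2 * b s ^ 2" for s
  define h2 where "h2 s = 96 * a s * b s ^ 4 - 32 * a s ^ 2 * b s" for s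
  have p2: "((\<lambda>y::real. (max 0 y) ^ 2) has_real_derivative 2 * max 0 y) (at y)" for y
    using has_real_derivative_pos_part_power[of 0 y] by (simp add: numeral_eq_Suc)
  have p3: "((\<lambda>y::real. (max 0 y) ^ 3) has_real_derivative 3 * (max 0 y) ^ 2) (at y)" for y
    using has_real_derivative_pos_part_power[of 1 y] by (simp add: numeral_eq_Suc)
  have lin: "((\<lambda>s::real. (s - 1/4) * (4/3)) has_real_derivative 4/3) (at s)" for s
    by (auto intro!: derivative_eq_intros)
  have b2: "((\<lambda>s. b s ^ 2) has_real_derivative 8/3 * b s) (at s)" for s
    unfolding b_def by (rule DERIV_cong[OF DERIV_chain2[OF p2 lin]]) simp
  have b3: "((\<lambda>s. b s ^ 3) has_real_derivative 4 * b s ^ 2) (at s)" for s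
    unfolding b_def by (rule DERIV_cong[OF DERIV_chain2[OF p3 lin]]) simp
  have inner: "((\<lambda>s. 1 - b s ^ 3) has_real_derivative - (4 * b s ^ 2)) (at s)" for s
    using DERIV_diff[OF DERIV_const b3, of 1 s] by simp
  have a2: "((\<lambda>s. a s ^ 2) has_real_derivative - 8 * a s * b s ^ 2) (at s)" for s
    unfolding a_def by (rule DERIV_cong[OF DERIV_chain2[OF p2 inner]]) simp
  have a3: "((\<lambda>s. a s ^ 3) has_real_derivative - 12 * a s ^ 2 * b s ^ 2) (at s)" for s
    unfolding a_def by (rule DERIV_cong[OF DERIV_chain2[OF p3 inner]]) simp
  have d1: "(h has_real_derivative h1 s) (at s)" for s
    using a3 unfolding h_def h1_def .
  have d2: "(h1 has_real_derivative h2 s) (at s)" for s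
    unfolding h1_def h2_def
    by (rule derivative_eq_intros a2 b2 refl)+ (simp add: algebra_simps numeral_eq_Suc)
  have c: "continuous_on UNIV h2"
    unfolding h2_def a_def b_def by (intro continuous_intros)
  have z1: "h s = 1 \<and> h1 s = 0 \<and> h2 s = 0" if "s \<le> 1/4" for s
    using that by (simp add: h_def h1_def h2_def a_def b_def)
  have b1: "b s \<ge> 1" if "s \<ge> 1" for s using that by (simp add: b_def)
  have z2: "a s = 0" if "b s \<ge> 1" for s using that by (simp add: a_def)
  have ab: "0 \<le> a s" "a s \<le> 1" "0 \<le> b s" "a s = 0 \<or> b s \<le> 1" for s
    using z2[of s] by (auto simp: a_def b_def)
  have bounds: "0 \<le> h s \<and> h s \<le> 1 \<and> \<bar>h1 s\<bar> \<le> 144 \<and> \<bar>h2 s\<bar> \<le> 144 \<and> (h1 s)\<^sup>2 \<le> 144 * h s" for s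
  proof (cases "a s = 0")
    case False
    then have b: "b s \<le> 1" using ab by blast
    have B: "0 \<le> b s ^ k" "b s ^ k \<le> 1" for k using ab b by (auto intro: power_le_one)
    have A: "0 \<le> a s ^ k" "a s ^ k \<le> 1" for k using ab by (auto intro: power_le_one)
    have AB: "0 \<le> a s ^ k * b s ^ l" "a s ^ k * b s ^ l \<le> 1" for k l
      using A[of k] B[of l] by (auto intro: mult_le_one)
    have "(h1 s)\<^sup>2 = 144 * (h s * (a s ^ 1 * b s ^ 4))"
      by (simp add: h1_def h_def power2_eq_square numeral_eq_Suc algebra_simps)
    also have "\<dots> \<le> 144 * h s"
      using AB[of 1 4] A[of 3] mult_left_mono[of "a s ^ 1 * b s ^ 4" 1 "h s"] by (simp add: h_def)
    finally have "(h1 s)\<^sup>2 \<le> 144 * h s" .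
    moreover have "\<bar>h1 s\<bar> \<le> 144"
      using AB[of 2 2] unfolding h1_def abs_le_iff mult.assoc by linarith
    moreover have "\<bar>h2 s\<bar> \<le> 144"
      using AB[of 1 4] AB[of 2 1] unfolding h2_def abs_le_iff mult.assoc by simp
    ultimately show ?thesis
      using A[of 3] by (simp add: h_def)
  qed (simp add: h_def h1_def h2_def)
  show ?thesis
    unfolding is_cutoff_def using d1 d2 c z1 z2 b1 bounds
    by (intro exI[of _ h] exI[of _ h1] exI[of _ h2]) (auto simp: h_def h1_def h2_def)
qed

lemma power_le_fact_exp:
  fixes y :: real assumes "0 \<le> y"
  shows "y ^ m \<le> fact m * exp y"
proof -
  have "(\<Sum>k\<in>{m}. y ^ k /\<^sub>R fact k) \<le> (\<Sum>k. y ^ k /\<^sub>R fact k)"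
    using assms summable_exp_generic[of y] by (intro sum_le_suminf) auto
  then show ?thesis by (simp add: exp_def field_simps)
qed

text \<open>In the scale-free variable \<open>y = \<rho>\<^sup>2 / (16 * \<tau>)\<close> the kernel
  is at most a constant times \<open>y powr (n / 2) * exp (- y) / \<rho> ^ n\<close>, and
  \<open>1 / \<tau>\<close> is \<open>16 * y / \<rho>\<^sup>2\<close>. Powers of \<open>y\<close>
  are absorbed by the exponential, so the bound survives as \<open>\<tau>\<close> tends to 0. The 16
  in the constant serves the second estimate.\<close>

lemma gaussian_annulus_bound:
  "\<exists>C\<ge>0. \<forall>\<tau> \<rho> S. \<tau> > 0 \<longrightarrow> \<rho> > 0 \<longrightarrow> S \<ge> \<rho>\<^sup>2 / 4 \<longrightarrow>
    (4 * pi * \<tau>) powr (- real n / 2) * exp (- S / (4 * \<tau>)) \<le> C / \<rho> ^ n \<and>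
    (4 * pi * \<tau>) powr (- real n / 2) * exp (- S / (4 * \<tau>)) / \<tau> \<le> C / \<rho> ^ (n + 2)"
proof -
  define c where "c = (pi / 4) powr (- real n / 2)"
  define F where "F = 1 + (fact (n + 1) :: real)"
  have c: "c \<ge> 0" by (simp add: c_def)
  have F: "F \<ge> 1" by (simp add: F_def)
  have "(4 * pi * \<tau>) powr (- real n / 2) * exp (- S / (4 * \<tau>)) \<le> 16 * c * F / \<rho> ^ n \<and>
    (4 * pi * \<tau>) powr (- real n / 2) * exp (- S / (4 * \<tau>)) / \<tau> \<le> 16 * c * F / \<rho> ^ (n + 2)"
    if \<tau>: "\<tau> > 0" and \<rho>: "\<rho> > 0" and S: "S \<ge> \<rho>\<^sup>2 / 4" for \<tau> \<rho> S
  proof -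
    define y where "y = \<rho>\<^sup>2 / (16 * \<tau>)"
    have y: "y > 0" using \<tau> \<rho> by (simp add: y_def)
    have "4 * pi * \<tau> = (pi / 4) * (\<rho>\<^sup>2 * inverse y)" using \<tau> \<rho> by (simp add: y_def field_simps)
    then have "(4 * pi * \<tau>) powr (- real n / 2) = c * (\<rho>\<^sup>2 powr (- real n / 2) * inverse y powr (- real n / 2))"
      by (simp only: c_def powr_mult)
    also have "\<rho>\<^sup>2 powr (- real n / 2) = 1 / \<rho> ^ n"
    proof -
      have "\<rho>\<^sup>2 powr (- real n / 2) = (\<rho> powr 2) powr (- real n / 2)"
        using \<rho> by (simp add: powr_numeral)
      also have "\<dots> = \<rho> powr (- real n)" by (simp add: powr_powr)
      finally show ?thesis using \<rho> by (simp add: powr_minus powr_realpow inverse_eq_divide)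
    qed
    also have "inverse y powr (- real n / 2) = y powr (real n / 2)"
      by (simp only: minus_divide_left[symmetric] powr_minus inverse_powr inverse_inverse_eq)
    finally have k: "(4 * pi * \<tau>) powr (- real n / 2) = c / \<rho> ^ n * y powr (real n / 2)" by simp
    \<comment> \<open>Replaces the possibly half-integral power by integral ones, which single terms
      of the exponential series control.\<close>
    have yp: "y powr (real n / 2) \<le> 1 + y ^ n"
    proof (cases "y \<le> 1")
      case True
      then have "y powr (real n / 2) \<le> 1" using y by (intro powr_le1) auto
      then show ?thesis using y by (simp add: add_increasing2)
    next
      case False
      then have "y powr (real n / 2) \<le> y powr real n" by (intro powr_mono) auto
      then show ?thesis using y by (simp add: powr_realpow)
    qed
    have "exp (- S / (4 * \<tau>)) \<le> exp (- y)"
      using S \<tau> by (simp add: y_def field_simps)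
    moreover have "(1 + y ^ n) * exp (- y) \<le> F"
    proof -
      have "y ^ n * exp (- y) \<le> fact n"
        using power_le_fact_exp[of y n] y by (simp add: exp_minus field_simps)
      moreover have "fact n \<le> (fact (n + 1) :: real)" by (rule fact_mono) simp
      moreover have "exp (- y) \<le> 1" using y by simp
      ultimately show ?thesis unfolding F_def distrib_right by linarith
    qed
    moreover have "(1 + y ^ n) * exp (- y) * y \<le> F"
    proof -
      have "y * exp (- y) \<le> 1"
        using order_trans[OF _ exp_ge_add_one_self, of y y] y by (simp add: exp_minus field_simps)
      moreover have "y ^ (n + 1) * exp (- y) \<le> fact (n + 1)"
        using power_le_fact_exp[of y "n + 1"] y by (simp add: exp_minus field_simps)
      ultimately show ?thesis by (simp add: F_def algebra_simps)
    qed
    ultimately have e1: "y powr (real n / 2) * exp (- S / (4 * \<tau>)) \<le> F"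
      and e2: "y powr (real n / 2) * exp (- S / (4 * \<tau>)) * y \<le> F"
    proof -
      assume a: "exp (- S / (4 * \<tau>)) \<le> exp (- y)" "(1 + y ^ n) * exp (- y) \<le> F" "(1 + y ^ n) * exp (- y) * y \<le> F"
      have m: "y powr (real n / 2) * exp (- S / (4 * \<tau>)) \<le> (1 + y ^ n) * exp (- y)"
        using yp a(1) y by (intro mult_mono) auto
      show "y powr (real n / 2) * exp (- S / (4 * \<tau>)) \<le> F" using m a(2) by linarith
      show "y powr (real n / 2) * exp (- S / (4 * \<tau>)) * y \<le> F"
        using mult_right_mono[OF m, of y] y a(3) by linarith
    qed
    have "c / \<rho> ^ n * (y powr (real n / 2) * exp (- S / (4 * \<tau>))) \<le> c / \<rho> ^ n * F"
      using e1 c \<rho> by (intro mult_left_mono) auto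
    also have "\<dots> \<le> 16 * c * F / \<rho> ^ n"
      using c F \<rho> by (simp add: field_simps)
    finally have 1: "(4 * pi * \<tau>) powr (- real n / 2) * exp (- S / (4 * \<tau>)) \<le> 16 * c * F / \<rho> ^ n"
      unfolding k by (simp add: mult.assoc)
    have "1 / \<tau> = 16 * y / \<rho>\<^sup>2" using \<tau> \<rho> by (simp add: y_def field_simps)
    then have "(4 * pi * \<tau>) powr (- real n / 2) * exp (- S / (4 * \<tau>)) / \<tau>
      = (16 * c / \<rho> ^ (n + 2)) * (y powr (real n / 2) * exp (- S / (4 * \<tau>)) * y)"
      unfolding k divide_inverse[of _ \<tau>] by (simp add: inverse_eq_divide power_add power2_eq_square field_simps)
    also have "\<dots> \<le> (16 * c / \<rho> ^ (n + 2)) * F"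
      using e2 c \<rho> by (intro mult_left_mono) auto
    finally show ?thesis using 1 by simp
  qed
  then show ?thesis using c F by (intro exI[of _ "16 * c * F"]) auto
qed

subsection \<open>Pointwise identities\<close>

text \<open>Dictionary: \<open>p\<close> is the gradient of u, \<open>H\<close> its Hessian,
  \<open>a\<close> its time derivative, \<open>q\<close> the gradient of \<open>a\<close>, and
  \<open>w\<close> is \<open>W' u\<close>. The left side is the time derivative of
  \<open>g * \<psi> * e\<close> plus the divergence of the flux, so the calculus is reduced to
  finite sums. The terms with \<open>q\<close> cancel directly, those with \<open>H\<close> applied
  to \<open>X\<close> by symmetry of \<open>H\<close>.\<close>

lemma energy_flux_identity:
  fixes p q gx \<psi>x X :: "'n::finite \<Rightarrow> real" and H gxx \<psi>xx M :: "'n \<Rightarrow> 'n \<Rightarrow> real"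
  assumes eps: "\<epsilon> \<noteq> 0" and sym: "\<And>i j. H i j = H j i"
    and a: "a = (\<Sum>j\<in>UNIV. H j j) - w / \<epsilon>\<^sup>2"
    and X: "\<And>i. X i = g * \<psi>x i - \<psi> * gx i"
    and M: "\<And>j i. M j i = gx j * \<psi>x i + g * \<psi>xx j i - (\<psi>x j * gx i + \<psi> * gxx j i)"
  shows "(gt * \<psi> + g * \<psi>t) * e + g * \<psi> * (\<epsilon> * (\<Sum>i\<in>UNIV. p i * q i) + w * a / \<epsilon>)
    + (\<Sum>j\<in>UNIV. (\<epsilon> * (\<Sum>k\<in>UNIV. p k * H j k) + w * p j / \<epsilon>) * X j + e * M j j
        - \<epsilon> * ((gx j * \<psi> + g * \<psi>x j) * a * p j + g * \<psi> * (q j * p j + a * H j j)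
             + H j j * (\<Sum>i\<in>UNIV. p i * X i) + p j * (\<Sum>i\<in>UNIV. H j i * X i + p i * M j i)))
    = \<psi> * (e * (gt - (\<Sum>j\<in>UNIV. gxx j j)) + \<epsilon> * (\<Sum>i\<in>UNIV. \<Sum>j\<in>UNIV. p i * p j * gxx i j))
    + g * (e * (\<psi>t + (\<Sum>j\<in>UNIV. \<psi>xx j j)) - \<epsilon> * (\<Sum>i\<in>UNIV. \<Sum>j\<in>UNIV. p i * p j * \<psi>xx i j)
        - 2 * \<epsilon> * a * (\<Sum>j\<in>UNIV. p j * \<psi>x j) - \<epsilon> * \<psi> * a\<^sup>2)"
proof -
  define A where "A = (\<Sum>j\<in>UNIV. p j * \<psi>x j)"
  define B where "B = (\<Sum>j\<in>UNIV. p j * gx j)"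
  define Q where "Q = (\<Sum>j\<in>UNIV. p j * q j)"
  define T where "T = (\<Sum>j\<in>UNIV. H j j)"
  define R where "R = (\<Sum>j\<in>UNIV. \<Sum>k\<in>UNIV. p k * H j k * X j)"
  define Gt where "Gt = (\<Sum>j\<in>UNIV. gxx j j)"
  define Pt where "Pt = (\<Sum>j\<in>UNIV. \<psi>xx j j)"
  define Gq where "Gq = (\<Sum>i\<in>UNIV. \<Sum>j\<in>UNIV. p i * p j * gxx i j)"
  define Pq where "Pq = (\<Sum>i\<in>UNIV. \<Sum>j\<in>UNIV. p i * p j * \<psi>xx i j)"
  have PX: "(\<Sum>i\<in>UNIV. p i * X i) = g * A - \<psi> * B"
    by (simp add: X A_def B_def algebra_simps sum_subtractf sum_distrib_left)
  have MM: "(\<Sum>j\<in>UNIV. M j j) = g * Pt - \<psi> * Gt"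
    by (simp add: M Pt_def Gt_def algebra_simps sum_subtractf sum.distrib sum_distrib_left)
  have R2: "(\<Sum>j\<in>UNIV. p j * (\<Sum>i\<in>UNIV. H j i * X i)) = R"
    unfolding R_def by (subst sum.swap) (simp add: sum_distrib_left sym algebra_simps)
  \<comment> \<open>The antisymmetric form of \<open>X\<close> pays off here: the products of first
    derivatives of \<open>g\<close> and \<open>\<psi>\<close> cancel in the quadratic form.\<close>
  have PM: "(\<Sum>j\<in>UNIV. p j * (\<Sum>i\<in>UNIV. p i * M j i)) = g * Pq - \<psi> * Gq"
  proof -
    have "(\<Sum>j\<in>UNIV. p j * (\<Sum>i\<in>UNIV. p i * M j i)) = (\<Sum>j\<in>UNIV. \<Sum>i\<in>UNIV.
        (p j * gx j) * (p i * \<psi>x i) - (p j * \<psi>x j) * (p i * gx i)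
        + (g * (p j * p i * \<psi>xx j i) - \<psi> * (p j * p i * gxx j i)))"
      by (simp add: M sum_distrib_left algebra_simps)
    also have "\<dots> = B * A - A * B + (g * Pq - \<psi> * Gq)"
      by (simp only: sum.distrib sum_subtractf A_def B_def Pq_def Gq_def sum_product)
        (simp only: sum_distrib_left)
    finally show ?thesis by simp
  qed
  have split: "(\<Sum>j\<in>UNIV. (\<epsilon> * (\<Sum>k\<in>UNIV. p k * H j k) + w * p j / \<epsilon>) * X j + e * M j j
        - \<epsilon> * ((gx j * \<psi> + g * \<psi>x j) * a * p j + g * \<psi> * (q j * p j + a * H j j)
             + H j j * (\<Sum>i\<in>UNIV. p i * X i) + p j * (\<Sum>i\<in>UNIV. H j i * X i + p i * M j i)))
    = \<epsilon> * R + w / \<epsilon> * (g * A - \<psi> * B) + e * (g * Pt - \<psi> * Gt)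
      - \<epsilon> * (\<psi> * a * B + g * a * A + g * \<psi> * Q + g * \<psi> * a * T + T * (g * A - \<psi> * B) + R + (g * Pq - \<psi> * Gq))"
  proof -
    have "(\<Sum>j\<in>UNIV. (\<epsilon> * (\<Sum>k\<in>UNIV. p k * H j k) + w * p j / \<epsilon>) * X j + e * M j j
        - \<epsilon> * ((gx j * \<psi> + g * \<psi>x j) * a * p j + g * \<psi> * (q j * p j + a * H j j)
             + H j j * (\<Sum>i\<in>UNIV. p i * X i) + p j * (\<Sum>i\<in>UNIV. H j i * X i + p i * M j i)))
     = (\<Sum>j\<in>UNIV. \<epsilon> * (\<Sum>k\<in>UNIV. p k * H j k * X j) + w / \<epsilon> * (p j * X j) + e * M j j
        - \<epsilon> * (\<psi> * a * (p j * gx j) + g * a * (p j * \<psi>x j) + g * \<psi> * (p j * q j) + g * \<psi> * a * H j j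
             + H j j * (g * A - \<psi> * B) + p j * (\<Sum>i\<in>UNIV. H j i * X i) + p j * (\<Sum>i\<in>UNIV. p i * M j i)))"
      unfolding PX by (intro sum.cong refl)
        (simp add: sum.distrib sum_distrib_left[symmetric] sum_distrib_right[symmetric] algebra_simps)
    also have "\<dots> = \<epsilon> * R + w / \<epsilon> * (\<Sum>i\<in>UNIV. p i * X i) + e * (\<Sum>j\<in>UNIV. M j j)
      - \<epsilon> * (\<psi> * a * B + g * a * A + g * \<psi> * Q + g * \<psi> * a * T + T * (g * A - \<psi> * B)
          + (\<Sum>j\<in>UNIV. p j * (\<Sum>i\<in>UNIV. H j i * X i)) + (\<Sum>j\<in>UNIV. p j * (\<Sum>i\<in>UNIV. p i * M j i)))"
      by (simp only: sum.distrib sum_subtractf sum_distrib_left[symmetric] sum_distrib_right[symmetric]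
          A_def B_def Q_def T_def R_def)
    finally show ?thesis by (simp only: PX MM R2 PM)
  qed
  \<comment> \<open>The equation enters at this point: eliminating \<open>w\<close> removes the
    trace of \<open>H\<close> and merges the remaining terms linear in \<open>a\<close> into
    \<open>- 2 * \<epsilon> * a * g * A\<close>.\<close>
  have w: "w = \<epsilon>\<^sup>2 * (T - a)" using a eps by (simp add: T_def field_simps)
  show ?thesis
    unfolding split unfolding A_def[symmetric] Q_def[symmetric] Gt_def[symmetric] Pt_def[symmetric] Gq_def[symmetric]
      Pq_def[symmetric] unfolding w
    using eps by (simp add: field_simps power2_eq_square)
qed

text \<open>The factor \<open>\<Phi>\<close> has been divided out. \<open>G\<close> is
  \<open>|\<nabla>u|\<^sup>2\<close>, \<open>S\<close> is \<open>|x - x0|\<^sup>2\<close>,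
  \<open>P\<close> is the inner product of the gradient with \<open>x - x0\<close>, and
  \<open>a\<close> is the time derivative of u. The terms without cutoff derivatives combine to
  \<open>r * h * (\<epsilon> * G - e)\<close>, which is nonpositive; every other term carries
  \<open>K\<close>.\<close>

lemma cutoff_weight_bound:
  fixes h h1 h2 K :: real
  assumes eps: "\<epsilon> > 0" and G: "0 \<le> G" and e: "\<epsilon> * G \<le> e" and CS: "P\<^sup>2 \<le> G * S" and S: "0 \<le> S" "\<beta> * S \<le> 2"
    and r: "r > 0" and b: "\<beta> > 0" and h: "0 \<le> h" "\<bar>h1\<bar> \<le> K" "\<bar>h2\<bar> \<le> K" "h1\<^sup>2 \<le> K * h" and N: "N \<ge> 0"
  shows "e * (- r * h - 2 * r * \<beta> * h1 * S + \<beta>\<^sup>2 * h2 * S + N * \<beta> * h1)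
      - \<epsilon> * ((r\<^sup>2 * h - 2 * r * \<beta> * h1 + \<beta>\<^sup>2 * h2) * P\<^sup>2 + (- r * h + \<beta> * h1) * G)
      - 2 * \<epsilon> * a * ((- r * h + \<beta> * h1) * P) - \<epsilon> * h * a\<^sup>2
    \<le> e * (K * (4 * r + (N + 7) * \<beta>))"
proof -
  have K: "K \<ge> 0" using h(2) by linarith
  have e0: "e \<ge> 0" using e eps G by (intro order_trans[OF _ e]) simp
  \<comment> \<open>Completing the square in \<open>a\<close>, multiplied by \<open>h\<close> to
    avoid division; where \<open>h\<close> is 0, the bound on \<open>h1\<^sup>2\<close> forces
    \<open>h1\<close> to vanish too. The terms \<open>r\<^sup>2 * h\<close> and
    \<open>2 * r * \<beta> * h1\<close> will cancel against the Hessian of the weight.\<close>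
  have sq: "- 2 * a * ((- r * h + \<beta> * h1) * P) - h * a\<^sup>2 \<le> (r\<^sup>2 * h - 2 * r * \<beta> * h1 + \<beta>\<^sup>2 * K) * P\<^sup>2"
  proof (cases "h = 0")
    case True
    then have "h1 = 0" using h(4) by simp
    then show ?thesis using True K by simp
  next
    case False
    then have h0: "h > 0" using h by simp
    let ?m = "- r * h + \<beta> * h1"
    have "h * (- 2 * a * (?m * P) - h * a\<^sup>2) = ?m\<^sup>2 * P\<^sup>2 - (h * a + ?m * P)\<^sup>2"
      by (simp add: power2_eq_square algebra_simps)
    also have "\<dots> \<le> ?m\<^sup>2 * P\<^sup>2" by simp
    also have "?m\<^sup>2 = h * (r\<^sup>2 * h - 2 * r * \<beta> * h1) + \<beta>\<^sup>2 * h1\<^sup>2"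
      by (simp add: power2_eq_square algebra_simps)
    also have "\<dots> * P\<^sup>2 \<le> (h * (r\<^sup>2 * h - 2 * r * \<beta> * h1) + \<beta>\<^sup>2 * (K * h)) * P\<^sup>2"
      using h(4) by (intro mult_right_mono add_left_mono mult_left_mono) auto
    also have "\<dots> = h * ((r\<^sup>2 * h - 2 * r * \<beta> * h1 + \<beta>\<^sup>2 * K) * P\<^sup>2)"
      by (simp add: algebra_simps)
    finally show ?thesis using h0 by simp
  qed
  have eP: "\<epsilon> * P\<^sup>2 \<le> e * S"
    using mult_left_mono[OF CS, of \<epsilon>] mult_right_mono[OF e S(1)] eps unfolding mult.assoc by linarith
  have prod: "X * y \<le> Z * K" if "\<bar>y\<bar> \<le> K" "0 \<le> X" "X \<le> Z" for X y Z :: real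
  proof -
    have "X * y \<le> X * K" using that by (intro mult_left_mono) auto
    also have "\<dots> \<le> Z * K" using that K by (intro mult_right_mono) auto
    finally show ?thesis .
  qed
  have bS: "\<beta> * e * (\<beta> * S) \<le> \<beta> * e * 2" using S b e0 by (intro mult_left_mono) auto
  have bP: "\<beta>\<^sup>2 * (\<epsilon> * P\<^sup>2) \<le> 2 * \<beta> * e"
    using mult_left_mono[OF eP, of "\<beta>\<^sup>2"] bS by (simp add: power2_eq_square algebra_simps)
  \<comment> \<open>The count behind the constant: \<open>t1\<close> gives \<open>4 * r\<close>,
    \<open>t3\<close> gives \<open>N * \<beta>\<close>, and \<open>t2\<close>, \<open>t4\<close>,
    \<open>t5\<close>, \<open>t6\<close> give 2 + 2 + 1 + 2 = 7 times \<open>\<beta>\<close>.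
    \<open>t7\<close> is the discrepancy estimate.\<close>
  have t1: "(2 * r * e * (\<beta> * S)) * (- h1) \<le> (4 * r * e) * K"
    using h(2) S b r e0 mult_left_mono[OF S(2), of "2 * r * e"] by (intro prod) auto
  have t2: "(\<beta> * e * (\<beta> * S)) * h2 \<le> (2 * \<beta> * e) * K"
    using h(3) S b e0 bS by (intro prod) auto
  have t3: "(N * \<beta> * e) * h1 \<le> (N * \<beta> * e) * K"
    using h(2) N b e0 by (intro prod) auto
  have t4: "(\<beta>\<^sup>2 * (\<epsilon> * P\<^sup>2)) * (- h2) \<le> (2 * \<beta> * e) * K"
    using h(3) bP eps by (intro prod) auto
  have t5: "(\<beta> * (\<epsilon> * G)) * (- h1) \<le> (\<beta> * e) * K"
    using h(2) b e eps G by (intro prod) auto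
  have t6: "(\<beta>\<^sup>2 * (\<epsilon> * P\<^sup>2)) * K \<le> (2 * \<beta> * e) * K"
    using bP K by (intro mult_right_mono) auto
  have t7: "r * h * (\<epsilon> * G) \<le> r * h * e"
    using e r h by (intro mult_left_mono) auto
  have "\<epsilon> * (- 2 * a * ((- r * h + \<beta> * h1) * P) - h * a\<^sup>2) \<le> \<epsilon> * ((r\<^sup>2 * h - 2 * r * \<beta> * h1 + \<beta>\<^sup>2 * K) * P\<^sup>2)"
    using sq eps by (intro mult_left_mono) auto
  with t1 t2 t3 t4 t5 t6 t7 show ?thesis
    by (simp add: power2_eq_square algebra_simps)
qed

subsection \<open>The weighted energy\<close>

lemma dirderiv_dx:
  fixes F :: "real^'n::finite \<Rightarrow> real \<Rightarrow> real"
  assumes "smooth_on U (\<lambda>(x, t). F x t)" "(x, t) \<in> U"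
  shows "((\<lambda>s. dirderiv vs (\<lambda>(x, t). F x t) (x + s *\<^sub>R v, t)) has_real_derivative
    dirderiv ((v, 0) # vs) (\<lambda>(x, t). F x t) (x, t)) (at 0)"
  using smooth_onD(2)[OF assms, of vs "(v, 0)"] by simp

lemma dirderiv_dt:
  fixes F :: "real^'n::finite \<Rightarrow> real \<Rightarrow> real"
  assumes "smooth_on U (\<lambda>(x, t). F x t)" "(x, t) \<in> U"
  shows "((\<lambda>s. dirderiv vs (\<lambda>(x, t). F x t) (x, s)) has_real_derivative
    dirderiv ((0, 1) # vs) (\<lambda>(x, t). F x t) (x, t)) (at t)"
  using smooth_onD(2)[OF assms, of vs "(0, 1)"]
    DERIV_shift[of "\<lambda>s. dirderiv vs (\<lambda>(x, t). F x t) (x, s)" _ 0 t] by (simp add: add.commute)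

lemma smooth_partials:
  fixes F :: "real^'n::finite \<Rightarrow> real \<Rightarrow> real"
  assumes "smooth_on U (\<lambda>(x, t). F x t)" "(x, t) \<in> U"
  shows "((\<lambda>s. F (x + s *\<^sub>R axis j 1) t) has_real_derivative sd j F x t) (at 0)"
    and "((\<lambda>s. sd i F (x + s *\<^sub>R axis j 1) t) has_real_derivative sdd j i F x t) (at 0)"
    and "(F x has_real_derivative td F x t) (at t)"
  using dirderiv_dx[OF assms, of "[]" "axis j 1"] dirderiv_dx[OF assms, of "[(axis i 1, 0)]" "axis j 1"]
    dirderiv_dt[OF assms, of "[]"]
  by (simp_all add: sd_def sdd_def td_def)

lemma smooth_partials_continuous:
  fixes F :: "real^'n::finite \<Rightarrow> real \<Rightarrow> real"
  assumes "smooth_on U (\<lambda>(x, t). F x t)"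
  shows "continuous_on U (\<lambda>z. F (fst z) (snd z))"
    and "continuous_on U (\<lambda>z. sd j F (fst z) (snd z))"
    and "continuous_on U (\<lambda>z. sdd i j F (fst z) (snd z))"
    and "continuous_on U (\<lambda>z. td F (fst z) (snd z))"
  using smooth_onD(1)[OF assms, of "[]"] smooth_onD(1)[OF assms, of "[(axis j 1, 0)]"]
    smooth_onD(1)[OF assms, of "[(axis i 1, 0), (axis j 1, 0)]"] smooth_onD(1)[OF assms, of "[(0, 1)]"]
  by (simp_all add: sd_def sdd_def td_def case_prod_unfold)

lemma norm_grad_sq: "(norm (grad u x t))\<^sup>2 = (\<Sum>i\<in>UNIV. (sd i u x t)\<^sup>2)"
  unfolding power2_norm_eq_inner inner_vec_def grad_def by (simp add: power2_eq_square)

lemma DERIV_W: "(W has_real_derivative W' y) (at y)"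
  unfolding W_def[abs_def] W'_def
  by (auto intro!: derivative_eq_intros simp: field_simps power2_eq_square)

lemma energy_derivative:
  fixes p :: "'n::finite \<Rightarrow> real \<Rightarrow> real"
  assumes "\<And>i. (p i has_real_derivative p' i) (at s)" "(v has_real_derivative v') (at s)"
  shows "((\<lambda>s. \<epsilon> * (\<Sum>i\<in>UNIV. (p i s)\<^sup>2) / 2 + W (v s) / \<epsilon>) has_real_derivative
    \<epsilon> * (\<Sum>i\<in>UNIV. p i s * p' i) + W' (v s) * v' / \<epsilon>) (at s)"
proof -
  have "((\<lambda>s. (p i s)\<^sup>2) has_real_derivative 2 * (p i s * p' i)) (at s)" for i
    by (auto intro!: derivative_eq_intros assms)
  then have "((\<lambda>s. \<Sum>i\<in>UNIV. (p i s)\<^sup>2) has_real_derivative (\<Sum>i\<in>UNIV. 2 * (p i s * p' i))) (at s)"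
    by (rule DERIV_sum)
  from DERIV_add[OF DERIV_cdivide[OF DERIV_cmult[OF this]] DERIV_cdivide[OF DERIV_chain2[OF DERIV_W assms(2)]]]
  show ?thesis by (rule DERIV_cong) (simp add: sum_distrib_left[symmetric])
qed

text \<open>The strict bound on u makes the potential positive, so the division by the energy
  density in the subsolution inequality is genuine. The second claim adds
  \<open>\<epsilon> |\<nabla>u|\<^sup>2 / 2\<close> to both sides of the discrepancy bound.\<close>

lemma AC_sol_energy:
  assumes "AC_sol \<epsilon> U u" "\<epsilon> > 0" "(x, t) \<in> U"
  shows "0 < edens \<epsilon> u x t" and "\<epsilon> * (\<Sum>i\<in>UNIV. (sd i u x t)\<^sup>2) \<le> edens \<epsilon> u x t"
proof -
  have d: "\<epsilon> * (\<Sum>i\<in>UNIV. (sd i u x t)\<^sup>2) / 2 - W (u x t) / \<epsilon> \<le> 0" and u: "\<bar>u x t\<bar> < 1"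
    using assms unfolding AC_sol_def norm_grad_sq by blast+
  have "(u x t)\<^sup>2 < 1" using u by (simp add: abs_square_less_1)
  then have "W (u x t) > 0" by (simp add: W_def)
  then have "W (u x t) / \<epsilon> > 0" using assms(2) by simp
  moreover have "0 \<le> \<epsilon> * (\<Sum>i\<in>UNIV. (sd i u x t)\<^sup>2) / 2" using assms(2) by (simp add: sum_nonneg)
  ultimately show "0 < edens \<epsilon> u x t" "\<epsilon> * (\<Sum>i\<in>UNIV. (sd i u x t)\<^sup>2) \<le> edens \<epsilon> u x t"
    using d unfolding edens_def norm_grad_sq by linarith+
qed

text \<open>\<open>g\<close> comes with explicit derivatives instead of \<open>smooth_on\<close>,
  because it will be \<open>f\<^sup>2\<close> or the square of a coordinate and the product rule
  supplies them. The first index of \<open>gxx\<close> is the direction differentiated last. The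
  subsolution inequality is multiplied by the energy density to avoid quotients.\<close>

locale weighted_energy =
  fixes \<epsilon> :: real and x0 :: "real^'n::finite" and t0 \<rho> :: real and U :: "((real^'n) \<times> real) set"
    and u g gt :: "real^'n \<Rightarrow> real \<Rightarrow> real" and gx :: "'n \<Rightarrow> real^'n \<Rightarrow> real \<Rightarrow> real"
    and gxx :: "'n \<Rightarrow> 'n \<Rightarrow> real^'n \<Rightarrow> real \<Rightarrow> real"
    and K :: real and h h1 h2 :: "real \<Rightarrow> real"
  assumes eps: "\<epsilon> > 0" and rho: "\<rho> > 0" and cyl: "cball x0 \<rho> \<times> {t0 - \<rho>\<^sup>2..<t0} \<subseteq> U"
    and AC: "AC_sol \<epsilon> U u"
    and g_dx: "\<And>x t j. (x, t) \<in> U \<Longrightarrow> ((\<lambda>s. g (x + s *\<^sub>R axis j 1) t) has_real_derivative gx j x t) (at 0)"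
    and gx_dx: "\<And>x t i j. (x, t) \<in> U \<Longrightarrow> ((\<lambda>s. gx i (x + s *\<^sub>R axis j 1) t) has_real_derivative gxx j i x t) (at 0)"
    and g_dt: "\<And>x t. (x, t) \<in> U \<Longrightarrow> (g x has_real_derivative gt x t) (at t)"
    and g_cont: "continuous_on U (\<lambda>z. g (fst z) (snd z))"
    and gx_cont: "\<And>i. continuous_on U (\<lambda>z. gx i (fst z) (snd z))"
    and gxx_cont: "\<And>i j. continuous_on U (\<lambda>z. gxx i j (fst z) (snd z))"
    and gt_cont: "continuous_on U (\<lambda>z. gt (fst z) (snd z))"
    and g_nonneg: "\<And>x t. (x, t) \<in> U \<Longrightarrow> 0 \<le> g x t"
    and g_sub: "\<And>x t. (x, t) \<in> U \<Longrightarrow> edens \<epsilon> u x t * (gt x t - (\<Sum>j\<in>UNIV. gxx j j x t))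
      + \<epsilon> * (\<Sum>i\<in>UNIV. \<Sum>j\<in>UNIV. sd i u x t * sd j u x t * gxx i j x t) \<le> 0"
    and cutoff: "is_cutoff K h h1 h2"
begin

lemma open_U: "open U" and smooth_u: "smooth_on U (\<lambda>(x, t). u x t)"
  and eqn: "(x, t) \<in> U \<Longrightarrow> td u x t = (\<Sum>j\<in>UNIV. sdd j j u x t) - W' (u x t) / \<epsilon>\<^sup>2"
  and discrepancy: "(x, t) \<in> U \<Longrightarrow> \<epsilon> * (\<Sum>i\<in>UNIV. (sd i u x t)\<^sup>2) \<le> edens \<epsilon> u x t"
proof -
  show "open U" "smooth_on U (\<lambda>(x, t). u x t)"
    using AC by (auto simp: AC_sol_def)
  show "td u x t = (\<Sum>j\<in>UNIV. sdd j j u x t) - W' (u x t) / \<epsilon>\<^sup>2" if "(x, t) \<in> U"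
    using AC that by (auto simp: AC_sol_def lap_def)
  show "\<epsilon> * (\<Sum>i\<in>UNIV. (sd i u x t)\<^sup>2) \<le> edens \<epsilon> u x t" if "(x, t) \<in> U"
    using AC_sol_energy(2)[OF AC eps that] .
qed

lemmas u_dx = smooth_partials(1)[OF smooth_u]
lemmas p_dx = smooth_partials(2)[OF smooth_u]
lemmas u_dt = smooth_partials(3)[OF smooth_u]

definition q :: "'n \<Rightarrow> real^'n \<Rightarrow> real \<Rightarrow> real" where
  "q j x t = dirderiv [(axis j 1, 0), (0, 1)] (\<lambda>(x, t). u x t) (x, t)"

lemma a_dx: "(x, t) \<in> U \<Longrightarrow> ((\<lambda>s. td u (x + s *\<^sub>R axis j 1) t) has_real_derivative q j x t) (at 0)"
  using dirderiv_dx[OF smooth_u, of x t "[(0, 1)]" "axis j 1"] by (simp add: q_def td_def)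

text \<open>\<open>q\<close> differentiates in time first and in space second, whereas the gradient
  of u differentiates in the opposite order; symmetry identifies the two, so that one function
  serves both \<open>e_dt\<close> and the divergence of the flux.\<close>

lemma p_dt: "(x, t) \<in> U \<Longrightarrow> (sd j u x has_real_derivative q j x t) (at t)"
  using dirderiv_dt[OF smooth_u, of x t "[(axis j 1, 0)]"]
    dirderiv_commute[OF smooth_u open_U, of "(x, t)" "(0, 1)" "(axis j 1, 0)"]
  by (simp add: q_def sd_def[abs_def])

lemma hess_sym: "(x, t) \<in> U \<Longrightarrow> sdd i j u x t = sdd j i u x t"
  unfolding sdd_def using dirderiv_commute[OF smooth_u open_U] .

lemma q_cont: "continuous_on U (\<lambda>z. q j (fst z) (snd z))"
  using smooth_onD(1)[OF smooth_u, of "[(axis j 1, 0), (0, 1)]"] by (simp add: q_def)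

abbreviation e where "e \<equiv> edens \<epsilon> u"

lemma e_eq: "e x t = \<epsilon> * (\<Sum>i\<in>UNIV. (sd i u x t)\<^sup>2) / 2 + W (u x t) / \<epsilon>"
  by (simp add: edens_def norm_grad_sq)

lemma e_nonneg: "0 \<le> e x t"
  using eps by (simp add: e_eq W_def sum_nonneg)

lemma e_dx:
  assumes "(x, t) \<in> U"
  shows "((\<lambda>s. e (x + s *\<^sub>R axis j 1) t) has_real_derivative
    \<epsilon> * (\<Sum>k\<in>UNIV. sd k u x t * sdd j k u x t) + W' (u x t) * sd j u x t / \<epsilon>) (at 0)"
  using energy_derivative[OF p_dx[OF assms, where j=j] u_dx[OF assms, where j=j], of \<epsilon>] by (simp add: e_eq)

lemma e_dt:
  assumes "(x, t) \<in> U"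
  shows "(e x has_real_derivative \<epsilon> * (\<Sum>k\<in>UNIV. sd k u x t * q k x t) + W' (u x t) * td u x t / \<epsilon>) (at t)"
  using energy_derivative[OF p_dt[OF assms] u_dt[OF assms], of \<epsilon>] by (simp add: e_eq[abs_def])

lemmas u_cont = smooth_partials_continuous[OF smooth_u]

lemma e_cont: "continuous_on U (\<lambda>z. e (fst z) (snd z))"
  unfolding e_eq W_def using eps by (intro continuous_intros u_cont) auto

text \<open>The weight \<open>\<psi>\<close> is the backward heat kernel times a cutoff in \<open>|x - x0|\<^sup>2 / \<rho>\<^sup>2\<close>; the functions
  \<open>\<psi>x\<close>, \<open>\<psi>xx\<close>, \<open>\<psi>t\<close> are its partial derivatives, written with \<open>r = 1 / (2 (t0 - t))\<close> and
  \<open>\<beta> = 2 / \<rho>\<^sup>2\<close>.\<close>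

definition \<Phi> where "\<Phi> x t = Phi (CARD('n) - 1) x0 t0 x t"
definition r where "r t = 1 / (2 * (t0 - t))"
definition \<beta> where "\<beta> = 2 / \<rho>\<^sup>2"
definition z where "z i x = (x - x0) $ i"
definition S where "S x = (norm (x - x0))\<^sup>2"
definition \<psi> where "\<psi> x t = \<Phi> x t * h (S x / \<rho>\<^sup>2)"
definition \<psi>x where "\<psi>x i x t = \<Phi> x t * ((- r t * h (S x / \<rho>\<^sup>2) + \<beta> * h1 (S x / \<rho>\<^sup>2)) * z i x)"
definition \<psi>xx where "\<psi>xx j i x t = \<Phi> x t *
  (((r t)\<^sup>2 * h (S x / \<rho>\<^sup>2) - 2 * r t * \<beta> * h1 (S x / \<rho>\<^sup>2) + \<beta>\<^sup>2 * h2 (S x / \<rho>\<^sup>2)) * (z i x * z j x)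
   + (- r t * h (S x / \<rho>\<^sup>2) + \<beta> * h1 (S x / \<rho>\<^sup>2)) * (if i = j then 1 else 0))"
definition \<psi>t where "\<psi>t x t = \<Phi> x t * (h (S x / \<rho>\<^sup>2) * ((real CARD('n) - 1) * r t - (r t)\<^sup>2 * S x))"

lemma z_dx: "((\<lambda>s. z i (x + s *\<^sub>R axis j 1)) has_real_derivative (if i = j then 1 else 0)) (at 0)"
  unfolding z_def axis_def by (auto intro!: derivative_eq_intros)

lemma S_dx: "((\<lambda>s. S (x + s *\<^sub>R axis j 1)) has_real_derivative 2 * z j x) (at 0)"
proof -
  have "S (x + s *\<^sub>R axis j 1) = S x + 2 * s * z j x + s\<^sup>2" for s
  proof -
    have "S (x + s *\<^sub>R axis j 1) = (x - x0 + s *\<^sub>R axis j 1) \<bullet> (x - x0 + s *\<^sub>R axis j 1)"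
      by (simp add: S_def power2_norm_eq_inner algebra_simps)
    also have "\<dots> = S x + 2 * s * ((x - x0) \<bullet> axis j 1) + s\<^sup>2"
      unfolding S_def power2_norm_eq_inner
      by (simp add: inner_add_left inner_add_right inner_axis_axis inner_commute power2_eq_square)
    finally show ?thesis by (simp add: inner_axis z_def)
  qed
  then show ?thesis by (auto intro!: derivative_eq_intros)
qed

lemma Phi_eq: "\<Phi> x t = (4 * pi * (t0 - t)) powr (- real (CARD('n) - 1) / 2) * exp (- S x / (4 * (t0 - t)))"
  by (simp add: \<Phi>_def Phi_def S_def)

lemma Phi_pos: "t < t0 \<Longrightarrow> 0 < \<Phi> x t"
  by (simp add: Phi_eq)

lemma Phi_dx:
  assumes "t < t0"
  shows "((\<lambda>s. \<Phi> (x + s *\<^sub>R axis j 1) t) has_real_derivative - r t * z j x * \<Phi> x t) (at 0)"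
proof -
  have "((\<lambda>s. - S (x + s *\<^sub>R axis j 1) / (4 * (t0 - t))) has_real_derivative - r t * z j x) (at 0)"
    using DERIV_cdivide[OF DERIV_minus[OF S_dx], of x j "4 * (t0 - t)"]
    by (rule DERIV_cong) (use assms in \<open>simp add: r_def field_simps\<close>)
  from DERIV_cmult[OF DERIV_fun_exp[OF this], of "(4 * pi * (t0 - t)) powr (- real (CARD('n) - 1) / 2)"]
  show ?thesis unfolding Phi_eq by (rule DERIV_cong) simp
qed

lemma Phi_dt:
  assumes "t < t0"
  shows "(\<Phi> x has_real_derivative ((real CARD('n) - 1) * r t - (r t)\<^sup>2 * S x) * \<Phi> x t) (at t)"
proof -
  have n: "real (CARD('n) - 1) = real CARD('n) - 1"
    by (simp add: of_nat_diff Suc_leI)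
  define k where "k = (4 * pi * (t0 - t)) powr (- real (CARD('n) - 1) / 2)"
  have 1: "((\<lambda>t. (4 * pi * (t0 - t)) powr (- real (CARD('n) - 1) / 2)) has_real_derivative
      (real CARD('n) - 1) * r t * k) (at t)"
  proof -
    have "((\<lambda>t. 4 * pi * (t0 - t)) has_real_derivative - (4 * pi)) (at t)"
      by (auto intro!: derivative_eq_intros)
    note d = DERIV_chain2[OF has_real_derivative_powr this]
    have k: "(4 * pi * (t0 - t)) powr (- real (CARD('n) - 1) / 2 - 1) = k / (4 * pi * (t0 - t))"
      using assms by (simp add: k_def powr_diff)
    have eq: "- real (CARD('n) - 1) / 2 * (4 * pi * (t0 - t)) powr (- real (CARD('n) - 1) / 2 - 1) * - (4 * pi)
      = (real CARD('n) - 1) * r t * k"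
      unfolding k unfolding n r_def using assms by (simp add: field_simps)
    show ?thesis by (rule DERIV_cong[OF d eq]) (use assms in simp)
  qed
  have 2: "((\<lambda>t. exp (- S x / (4 * (t0 - t)))) has_real_derivative
      - ((r t)\<^sup>2 * S x) * exp (- S x / (4 * (t0 - t)))) (at t)"
  proof -
    have "((\<lambda>t. t0 - t) has_real_derivative - 1) (at t)" by (auto intro!: derivative_eq_intros)
    note d = DERIV_fun_exp[OF DERIV_cmult[OF DERIV_inverse'[OF this], of "- S x / 4"]]
    have "- S x / (4 * (t0 - t)) = - S x / 4 * inverse (t0 - t)" for t by (simp add: inverse_eq_divide)
    moreover have "(r t)\<^sup>2 = inverse (t0 - t) * inverse (t0 - t) / 4"
      by (simp add: r_def power2_eq_square inverse_eq_divide) (simp add: algebra_simps)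
    ultimately show ?thesis
      by (simp only:) (rule DERIV_cong[OF d], use assms in simp_all)
  qed
  show ?thesis
    using DERIV_mult[OF 1 2] unfolding Phi_eq[abs_def] k_def[symmetric] by (simp add: algebra_simps)
qed

lemma cutoff_deriv: "(h has_real_derivative h1 s) (at s)" "(h1 has_real_derivative h2 s) (at s)"
  using cutoff by (auto simp: is_cutoff_def)

lemma cutoff_dx:
  "((\<lambda>s. h (S (x + s *\<^sub>R axis j 1) / \<rho>\<^sup>2)) has_real_derivative \<beta> * h1 (S x / \<rho>\<^sup>2) * z j x) (at 0)"
  "((\<lambda>s. h1 (S (x + s *\<^sub>R axis j 1) / \<rho>\<^sup>2)) has_real_derivative \<beta> * h2 (S x / \<rho>\<^sup>2) * z j x) (at 0)"
proof -
  have "((\<lambda>s. S (x + s *\<^sub>R axis j 1) / \<rho>\<^sup>2) has_real_derivative \<beta> * z j x) (at 0)"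
    using DERIV_cdivide[OF S_dx, of x j "\<rho>\<^sup>2"] by (simp add: \<beta>_def)
  from DERIV_chain2[OF cutoff_deriv(1) this] DERIV_chain2[OF cutoff_deriv(2) this]
  show "((\<lambda>s. h (S (x + s *\<^sub>R axis j 1) / \<rho>\<^sup>2)) has_real_derivative \<beta> * h1 (S x / \<rho>\<^sup>2) * z j x) (at 0)"
    "((\<lambda>s. h1 (S (x + s *\<^sub>R axis j 1) / \<rho>\<^sup>2)) has_real_derivative \<beta> * h2 (S x / \<rho>\<^sup>2) * z j x) (at 0)"
    by (simp_all add: mult_ac)
qed

lemma psi_dx:
  assumes "t < t0"
  shows "((\<lambda>s. \<psi> (x + s *\<^sub>R axis j 1) t) has_real_derivative \<psi>x j x t) (at 0)"
  unfolding \<psi>_def \<psi>x_def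
  by (rule derivative_eq_intros Phi_dx cutoff_dx assms refl)+ (simp add: algebra_simps)

lemma psix_dx:
  assumes "t < t0"
  shows "((\<lambda>s. \<psi>x i (x + s *\<^sub>R axis j 1) t) has_real_derivative \<psi>xx j i x t) (at 0)"
  unfolding \<psi>x_def \<psi>xx_def
  by (rule derivative_eq_intros Phi_dx cutoff_dx z_dx assms refl)+
    (simp add: algebra_simps power2_eq_square)

lemma psi_dt:
  assumes "t < t0"
  shows "(\<psi> x has_real_derivative \<psi>t x t) (at t)"
  unfolding \<psi>_def[abs_def] \<psi>t_def
  by (rule derivative_eq_intros Phi_dt assms refl)+ (simp add: algebra_simps)

text \<open>\<open>U\<close> may extend beyond \<open>t0\<close>, where the kernel is singular; all
  continuity statements involving the weight live on this part.\<close>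

definition "V = U \<inter> UNIV \<times> {..<t0}"

lemma S_cont [continuous_intros]: "continuous_on A (\<lambda>y. S (fst y))"
  unfolding S_def by (intro continuous_intros)

lemma z_cont [continuous_intros]: "continuous_on A (\<lambda>y. z i (fst y))"
  unfolding z_def by (intro continuous_intros)

lemma r_cont [continuous_intros]: "continuous_on V (\<lambda>y. r (snd y))"
  unfolding r_def V_def by (intro continuous_intros) auto

lemma Phi_cont [continuous_intros]: "continuous_on V (\<lambda>y. \<Phi> (fst y) (snd y))"
  unfolding Phi_eq V_def by (intro continuous_intros) auto

lemma cutoff_cont [continuous_intros]:
  "continuous_on A (\<lambda>y. h (S (fst y) / \<rho>\<^sup>2))"
  "continuous_on A (\<lambda>y. h1 (S (fst y) / \<rho>\<^sup>2))"
  "continuous_on A (\<lambda>y. h2 (S (fst y) / \<rho>\<^sup>2))"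
proof -
  have c: "continuous_on UNIV h" "continuous_on UNIV h1" "continuous_on UNIV h2"
    using cutoff_deriv cutoff by (auto intro!: continuous_at_imp_continuous_on DERIV_isCont simp: is_cutoff_def)
  show "continuous_on A (\<lambda>y. h (S (fst y) / \<rho>\<^sup>2))"
    "continuous_on A (\<lambda>y. h1 (S (fst y) / \<rho>\<^sup>2))"
    "continuous_on A (\<lambda>y. h2 (S (fst y) / \<rho>\<^sup>2))"
    using rho by (auto intro!: continuous_on_compose2[OF c(1)] continuous_on_compose2[OF c(2)]
      continuous_on_compose2[OF c(3)] continuous_intros)
qed

lemma psi_cont [continuous_intros]:
  "continuous_on V (\<lambda>y. \<psi> (fst y) (snd y))"
  "continuous_on V (\<lambda>y. \<psi>x i (fst y) (snd y))"
  "continuous_on V (\<lambda>y. \<psi>xx i j (fst y) (snd y))"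
  "continuous_on V (\<lambda>y. \<psi>t (fst y) (snd y))"
  unfolding \<psi>_def \<psi>x_def \<psi>xx_def \<psi>t_def by (intro continuous_intros)+

lemma U_cont_V:
  assumes "continuous_on U f" shows "continuous_on V f"
  using assms by (rule continuous_on_subset) (auto simp: V_def)

lemmas data_cont_V [continuous_intros] =
  U_cont_V[OF g_cont] U_cont_V[OF gx_cont] U_cont_V[OF gxx_cont] U_cont_V[OF gt_cont]
  U_cont_V[OF q_cont] U_cont_V[OF e_cont] u_cont[THEN U_cont_V]

text \<open>The flux \<open>Y\<close> below comes from two conservation laws. With \<open>p = \<nabla>u\<close>, the energy density satisfies
  \<open>\<partial>\<^sub>t e = div (\<epsilon> u\<^sub>t p) - \<epsilon> u\<^sub>t\<^sup>2\<close>, and the stress tensor \<open>T = e I - \<epsilon> p \<otimes> p\<close> satisfies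
  \<open>div T = - \<epsilon> u\<^sub>t p\<close>. Testing the latter with the field \<open>X = g \<nabla>\<psi> - \<psi> \<nabla>g\<close> moves the second
  derivatives onto \<open>\<psi>\<close> and \<open>g\<close> so that only the subsolution operator acts on \<open>g\<close>.\<close>

definition "X i x t = g x t * \<psi>x i x t - \<psi> x t * gx i x t"
definition "M j i x t = gx j x t * \<psi>x i x t + g x t * \<psi>xx j i x t - (\<psi>x j x t * gx i x t + \<psi> x t * gxx j i x t)"
definition "PX x t = (\<Sum>i\<in>UNIV. sd i u x t * X i x t)"
definition "Y j x t = e x t * X j x t
  - \<epsilon> * (g x t * \<psi> x t * (td u x t * sd j u x t) + sd j u x t * PX x t)"
definition "Y' j x t =
  (\<epsilon> * (\<Sum>k\<in>UNIV. sd k u x t * sdd j k u x t) + W' (u x t) * sd j u x t / \<epsilon>) * X j x t + e x t * M j j x t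
        - \<epsilon> * ((gx j x t * \<psi> x t + g x t * \<psi>x j x t) * td u x t * sd j u x t
             + g x t * \<psi> x t * (q j x t * sd j u x t + td u x t * sdd j j u x t)
             + sdd j j u x t * (\<Sum>i\<in>UNIV. sd i u x t * X i x t)
             + sd j u x t * (\<Sum>i\<in>UNIV. sdd j i u x t * X i x t + sd i u x t * M j i x t))"
definition "E x t = g x t * \<psi> x t * e x t"
definition "E' x t = (gt x t * \<psi> x t + g x t * \<psi>t x t) * e x t
  + g x t * \<psi> x t * (\<epsilon> * (\<Sum>k\<in>UNIV. sd k u x t * q k x t) + W' (u x t) * td u x t / \<epsilon>)"

section \<open>Derivatives and continuity of the flux and of the weighted energy density\<close>

lemma X_dx:
  assumes "(x, t) \<in> V"
  shows "((\<lambda>s. X i (x + s *\<^sub>R axis j 1) t) has_real_derivative M j i x t) (at 0)"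
proof -
  have a: "(x, t) \<in> U" "t < t0" using assms by (auto simp: V_def)
  show ?thesis
    unfolding X_def M_def
    using DERIV_diff[OF DERIV_mult[OF g_dx[OF a(1), where j=j] psix_dx[OF a(2), of i x j]]
        DERIV_mult[OF psi_dx[OF a(2), of x j] gx_dx[OF a(1), where i=i and j=j]]]
    by (rule DERIV_cong) (simp add: algebra_simps)
qed

lemma PX_dx:
  assumes "(x, t) \<in> V"
  shows "((\<lambda>s. PX (x + s *\<^sub>R axis j 1) t) has_real_derivative
    (\<Sum>i\<in>UNIV. sdd j i u x t * X i x t + sd i u x t * M j i x t)) (at 0)"
proof -
  have a: "(x, t) \<in> U" using assms by (auto simp: V_def)
  have "((\<lambda>s. sd i u (x + s *\<^sub>R axis j 1) t * X i (x + s *\<^sub>R axis j 1) t) has_real_derivative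
    sdd j i u x t * X i x t + sd i u x t * M j i x t) (at 0)" for i
    using DERIV_mult[OF p_dx[OF a, where i=i and j=j] X_dx[OF assms, of i j]]
    by (rule DERIV_cong) simp
  then show ?thesis unfolding PX_def by (rule DERIV_sum)
qed

lemma Y_dx:
  assumes "(x, t) \<in> V"
  shows "((\<lambda>s. Y j (x + s *\<^sub>R axis j 1) t) has_real_derivative Y' j x t) (at 0)"
proof -
  have a: "(x, t) \<in> U" "t < t0" using assms by (auto simp: V_def)
  show ?thesis
    unfolding Y_def Y'_def
    using DERIV_diff[OF DERIV_mult[OF e_dx[OF a(1), of j] X_dx[OF assms, of j j]]
        DERIV_cmult[OF DERIV_add[OF DERIV_mult[OF DERIV_mult[OF g_dx[OF a(1), where j=j] psi_dx[OF a(2), of x j]]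
          DERIV_mult[OF a_dx[OF a(1), of j] p_dx[OF a(1), where i=j and j=j]]]
          DERIV_mult[OF p_dx[OF a(1), where i=j and j=j] PX_dx[OF assms, of j]]], of \<epsilon>]]
    by (rule DERIV_cong) (simp add: PX_def algebra_simps)
qed

lemma E_dt:
  assumes "(x, t) \<in> V"
  shows "(E x has_real_derivative E' x t) (at t)"
proof -
  have a: "(x, t) \<in> U" "t < t0" using assms by (auto simp: V_def)
  show ?thesis
    unfolding E_def[abs_def] E'_def
    using DERIV_mult[OF DERIV_mult[OF g_dt[OF a(1)] psi_dt[OF a(2), of x]] e_dt[OF a(1)]]
    by (rule DERIV_cong) (simp add: algebra_simps)
qed

lemma W'_cont: "continuous_on V (\<lambda>y. W' (u (fst y) (snd y)))"
  unfolding W'_def by (intro continuous_intros)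

lemma flux_cont:
  "continuous_on V (\<lambda>y. Y j (fst y) (snd y))"
  "continuous_on V (\<lambda>y. Y' j (fst y) (snd y))"
  "continuous_on V (\<lambda>y. E (fst y) (snd y))"
  "continuous_on V (\<lambda>y. E' (fst y) (snd y))"
  unfolding Y_def Y'_def PX_def E_def E'_def X_def M_def using eps
  by (intro continuous_intros W'_cont; simp)+

section \<open>Vanishing from the boundary sphere outwards, and the divergence theorem\<close>

lemma psi_outside:
  assumes "\<rho> \<le> norm (x - x0)"
  shows "\<psi> x t = 0" "\<psi>x i x t = 0" "\<psi>xx j i x t = 0" "\<psi>t x t = 0"
proof -
  have "S x / \<rho>\<^sup>2 \<ge> 1"
    using power_mono[OF assms, of 2] rho by (simp add: S_def)
  then have "h (S x / \<rho>\<^sup>2) = 0 \<and> h1 (S x / \<rho>\<^sup>2) = 0 \<and> h2 (S x / \<rho>\<^sup>2) = 0"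
    using cutoff by (simp add: is_cutoff_def)
  then show "\<psi> x t = 0" "\<psi>x i x t = 0" "\<psi>xx j i x t = 0" "\<psi>t x t = 0"
    by (simp_all add: \<psi>_def \<psi>x_def \<psi>xx_def \<psi>t_def)
qed

lemma flux_outside:
  assumes "\<rho> \<le> norm (x - x0)"
  shows "Y j x t = 0" "Y' j x t = 0" "E x t = 0" "E' x t = 0"
  unfolding Y_def Y'_def PX_def E_def E'_def X_def M_def by (simp_all add: psi_outside[OF assms])

lemma slice: "open {x. (x, t) \<in> U}"
proof -
  have "open ((\<lambda>x. (x, t)) -` U)" using open_U by (intro open_vimage continuous_intros)
  then show ?thesis by (simp add: vimage_def)
qed

text \<open>The slice of \<open>U\<close> is an open neighbourhood of the closed ball, and flux and
  derivative vanish off the open ball; extended by zero they have compact support, so each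
  \<open>Y' j\<close>, a derivative of \<open>Y j\<close> in direction j, integrates to 0
  separately.\<close>

lemma integral_divergence:
  assumes "t0 - \<rho>\<^sup>2 \<le> t" "t < t0"
  shows "integrable lborel (\<lambda>x. indicator (cball x0 \<rho>) x * Y' j x t)"
    and "(\<integral>x. indicator (cball x0 \<rho>) x * Y' j x t \<partial>lborel) = 0"
proof -
  let ?V = "{x. (x, t) \<in> U}"
  have sub: "cball x0 \<rho> \<subseteq> ?V" using cyl assms by auto
  have V: "(x, t) \<in> V" if "x \<in> ?V" for x using that assms by (simp add: V_def)
  have out: "\<rho> \<le> norm (x - x0)" if "x \<notin> cball x0 \<rho>" for x
    using that by (simp add: dist_norm norm_minus_commute)
  have cont: "continuous_on ?V (\<lambda>x. f x t)" if "continuous_on V (\<lambda>y. f (fst y) (snd y))" for f :: "real^'n \<Rightarrow> real \<Rightarrow> real"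
  proof -
    have "continuous_on ?V (\<lambda>x. f (fst (x, t)) (snd (x, t)))"
      using V by (intro continuous_on_compose2[OF that, of ?V "\<lambda>x. (x, t)"] continuous_intros) auto
    then show ?thesis by simp
  qed
  have cY: "continuous_on UNIV (\<lambda>x. indicator (cball x0 \<rho>) x * Y j x t)"
    using flux_outside(1) out by (intro continuous_on_zero_extension[OF slice _ sub] cont flux_cont) auto
  have cY': "continuous_on UNIV (\<lambda>x. indicator (cball x0 \<rho>) x * Y' j x t)"
    using flux_outside(2) out by (intro continuous_on_zero_extension[OF slice _ sub] cont flux_cont) auto
  show "integrable lborel (\<lambda>x. indicator (cball x0 \<rho>) x * Y' j x t)"
    using cY' by (rule integrable_continuous_compact_support[where K="cball x0 \<rho>"]) auto
  show "(\<integral>x. indicator (cball x0 \<rho>) x * Y' j x t \<partial>lborel) = 0"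
  proof (rule integral_directional_derivative_eq_0[OF _ cY cY', where v="axis j 1" and K="cball x0 \<rho>"])
    show "((\<lambda>s. indicator (cball x0 \<rho>) (x + s *\<^sub>R axis j 1) * Y j (x + s *\<^sub>R axis j 1) t) has_real_derivative
         indicator (cball x0 \<rho>) x * Y' j x t) (at 0)" for x
      using flux_outside(1,2) out
      by (intro directional_derivative_zero_extension[OF slice _ sub] Y_dx V) auto
  qed auto
qed

text \<open>Two regions are treated differently: on the inner ball the Gaussian is unbounded as time
  approaches \<open>t0\<close>, so there the bracket must be nonpositive; only on the annulus may it
  be estimated by a constant.\<close>

lemma weight_inequality:
  assumes C: "0 \<le> C" "\<And>\<tau> \<rho> S. \<tau> > 0 \<Longrightarrow> \<rho> > 0 \<Longrightarrow> S \<ge> \<rho>\<^sup>2 / 4 \<Longrightarrow>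
    (4 * pi * \<tau>) powr (- real (CARD('n) - 1) / 2) * exp (- S / (4 * \<tau>)) \<le> C / \<rho> ^ (CARD('n) - 1) \<and>
    (4 * pi * \<tau>) powr (- real (CARD('n) - 1) / 2) * exp (- S / (4 * \<tau>)) / \<tau> \<le> C / \<rho> ^ (CARD('n) - 1 + 2)"
    and x: "(x, t) \<in> V" "x \<in> ball x0 \<rho>"
  shows "e x t * (\<psi>t x t + (\<Sum>j\<in>UNIV. \<psi>xx j j x t))
      - \<epsilon> * (\<Sum>i\<in>UNIV. \<Sum>j\<in>UNIV. sd i u x t * sd j u x t * \<psi>xx i j x t)
      - 2 * \<epsilon> * td u x t * (\<Sum>j\<in>UNIV. sd j u x t * \<psi>x j x t) - \<epsilon> * \<psi> x t * (td u x t)\<^sup>2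
    \<le> e x t * (K * C * (2 * real CARD('n) + 16) / \<rho> ^ (CARD('n) + 1))" (is "?L \<le> _")
proof -
  have a: "(x, t) \<in> U" "t < t0" using x by (auto simp: V_def)
  let ?h = "h (S x / \<rho>\<^sup>2)" let ?h1 = "h1 (S x / \<rho>\<^sup>2)" let ?h2 = "h2 (S x / \<rho>\<^sup>2)"
  define G where "G = (\<Sum>i\<in>UNIV. (sd i u x t)\<^sup>2)"
  define P where "P = (\<Sum>i\<in>UNIV. sd i u x t * z i x)"
  define \<alpha> where "\<alpha> = (r t)\<^sup>2 * ?h - 2 * r t * \<beta> * ?h1 + \<beta>\<^sup>2 * ?h2"
  define m where "m = - r t * ?h + \<beta> * ?h1"
  have Sz: "S x = (\<Sum>i\<in>UNIV. (z i x)\<^sup>2)"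
    unfolding S_def z_def power2_norm_eq_inner inner_vec_def by (simp add: power2_eq_square)
  have pxx: "\<psi>xx j i x t = \<Phi> x t * (\<alpha> * (z i x * z j x) + m * (if i = j then 1 else 0))" for i j
    unfolding \<psi>xx_def \<alpha>_def m_def ..
  have tr: "(\<Sum>j\<in>UNIV. \<psi>xx j j x t) = \<Phi> x t * (\<alpha> * S x + real CARD('n) * m)"
    unfolding pxx Sz by (simp add: sum_distrib_left[symmetric] sum.distrib power2_eq_square)
  have quad: "(\<Sum>i\<in>UNIV. \<Sum>j\<in>UNIV. sd i u x t * sd j u x t * \<psi>xx i j x t) = \<Phi> x t * (\<alpha> * P\<^sup>2 + m * G)"
  proof -
    have "(\<Sum>i\<in>UNIV. \<Sum>j\<in>UNIV. sd i u x t * sd j u x t * \<psi>xx i j x t)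
      = (\<Sum>i\<in>UNIV. \<Sum>j\<in>UNIV. \<Phi> x t * (\<alpha> * ((sd i u x t * z i x) * (sd j u x t * z j x)))
          + (if i = j then \<Phi> x t * (m * (sd i u x t)\<^sup>2) else 0))"
      by (intro sum.cong refl)
        (auto simp: pxx power2_eq_square algebra_simps)
    also have "\<dots> = \<Phi> x t * (\<alpha> * (P * P)) + \<Phi> x t * (m * G)"
      by (simp add: sum.distrib sum_distrib_left[symmetric] sum_distrib_right[symmetric] P_def G_def)
    finally show ?thesis by (simp add: power2_eq_square algebra_simps)
  qed
  have lin: "(\<Sum>j\<in>UNIV. sd j u x t * \<psi>x j x t) = \<Phi> x t * (m * P)"
  proof -
    have "\<psi>x j x t = \<Phi> x t * (m * z j x)" for j by (simp add: \<psi>x_def m_def)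
    then show ?thesis by (simp add: P_def sum_distrib_left mult_ac)
  qed
  have tpart: "\<psi>t x t = \<Phi> x t * (?h * ((real CARD('n) - 1) * r t - (r t)\<^sup>2 * S x))"
    by (simp add: \<psi>t_def)
  \<comment> \<open>The trace of the Hessian contributes \<open>- real CARD('n) * r t\<close> and
    the time derivative \<open>(real CARD('n) - 1) * r t\<close>, both times the cutoff; the
    mismatch by one leaves \<open>- r t * ?h\<close>. The terms with
    \<open>(r t)\<^sup>2 * S x\<close> cancel.\<close>
  have L: "?L = \<Phi> x t * (e x t * (- r t * ?h - 2 * r t * \<beta> * ?h1 * S x + \<beta>\<^sup>2 * ?h2 * S x + real CARD('n) * \<beta> * ?h1)
      - \<epsilon> * (((r t)\<^sup>2 * ?h - 2 * r t * \<beta> * ?h1 + \<beta>\<^sup>2 * ?h2) * P\<^sup>2 + (- r t * ?h + \<beta> * ?h1) * G)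
      - 2 * \<epsilon> * td u x t * ((- r t * ?h + \<beta> * ?h1) * P) - \<epsilon> * ?h * (td u x t)\<^sup>2)"
    unfolding tr quad lin tpart \<psi>_def \<alpha>_def m_def by (simp add: algebra_simps)
  have CS: "P\<^sup>2 \<le> G * S x"
    unfolding P_def G_def Sz by (rule Cauchy_Schwarz_ineq_sum)
  have G: "0 \<le> G" by (simp add: G_def sum_nonneg)
  have eG: "\<epsilon> * G \<le> e x t" using discrepancy[OF a(1)] by (simp add: G_def)
  have r: "r t > 0" using a by (simp add: r_def)
  have b: "\<beta> > 0" using rho by (simp add: \<beta>_def)
  have S: "0 \<le> S x" "S x \<le> \<rho>\<^sup>2" "\<beta> * S x \<le> 2"
  proof -
    show "0 \<le> S x" by (simp add: S_def)
    show s: "S x \<le> \<rho>\<^sup>2"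
      using x unfolding S_def by (intro power_mono) (auto simp: dist_norm norm_minus_commute)
    then show "\<beta> * S x \<le> 2" using rho by (simp add: \<beta>_def field_simps)
  qed
  have hb: "0 \<le> ?h" "\<bar>?h1\<bar> \<le> K" "\<bar>?h2\<bar> \<le> K" "?h1\<^sup>2 \<le> K * ?h"
    using cutoff by (simp_all add: is_cutoff_def)
  have K: "K \<ge> 0" using hb by linarith
  have \<Phi>0: "0 < \<Phi> x t" using Phi_pos a by simp
  show ?thesis
  proof (cases "S x / \<rho>\<^sup>2 \<le> 1/4")
    case True
    then have flat: "?h1 = 0" "?h2 = 0" using cutoff by (simp_all add: is_cutoff_def)
    \<comment> \<open>Since both cutoff derivatives are 0 here, the pointwise bound applies with 0
      in place of \<open>K\<close>.\<close>
    have "?L \<le> \<Phi> x t * (e x t * (0 * (4 * r t + (real CARD('n) + 7) * \<beta>)))"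
      unfolding L using \<Phi>0 flat hb
      by (intro mult_left_mono cutoff_weight_bound[OF eps G eG CS S(1,3) r b]) auto
    also have "\<dots> \<le> e x t * (K * C * (2 * real CARD('n) + 16) / \<rho> ^ (CARD('n) + 1))"
      using K C rho e_nonneg by simp
    finally show ?thesis .
  next
    case False
    then have far: "S x \<ge> \<rho>\<^sup>2 / 4" using rho by (simp add: field_simps)
    have N: "CARD('n) - 1 + 2 = CARD('n) + 1" by (simp add: Suc_leI)
    have 1: "\<Phi> x t \<le> C / \<rho> ^ (CARD('n) - 1)" and 2: "\<Phi> x t / (t0 - t) \<le> C / \<rho> ^ (CARD('n) + 1)"
      using C(2)[of "t0 - t" \<rho> "S x"] far rho a unfolding Phi_eq N by auto
    have 3: "\<Phi> x t * \<beta> \<le> 2 * (C / \<rho> ^ (CARD('n) + 1))"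
    proof -
      have "\<Phi> x t * \<beta> \<le> C / \<rho> ^ (CARD('n) - 1) * \<beta>" using 1 b by (intro mult_right_mono) auto
      also have "\<dots> = 2 * (C / \<rho> ^ (CARD('n) - 1 + 2))" unfolding \<beta>_def power_add by (simp add: mult_ac)
      finally show ?thesis unfolding N .
    qed
    \<comment> \<open>As \<open>4 * r t\<close> is \<open>2 / (t0 - t)\<close> and
      \<open>\<beta>\<close> is \<open>2 / \<rho>\<^sup>2\<close>, the multiples of \<open>C\<close>
      are 2 and \<open>2 * (real CARD('n) + 7)\<close>, together
      \<open>2 * real CARD('n) + 16\<close>.\<close>
    have "\<Phi> x t * (4 * r t + (real CARD('n) + 7) * \<beta>) = 2 * (\<Phi> x t / (t0 - t)) + (real CARD('n) + 7) * (\<Phi> x t * \<beta>)"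
      using a by (simp add: r_def field_simps)
    also have "\<dots> \<le> 2 * (C / \<rho> ^ (CARD('n) + 1)) + (real CARD('n) + 7) * (2 * (C / \<rho> ^ (CARD('n) + 1)))"
      using 2 3 by (intro add_mono mult_left_mono) auto
    finally have 4: "\<Phi> x t * (4 * r t + (real CARD('n) + 7) * \<beta>)
      \<le> C * (2 * real CARD('n) + 16) / \<rho> ^ (CARD('n) + 1)"
      by (simp add: algebra_simps add_divide_distrib)
    have "?L \<le> \<Phi> x t * (e x t * (K * (4 * r t + (real CARD('n) + 7) * \<beta>)))"
      unfolding L using \<Phi>0 hb
      by (intro mult_left_mono cutoff_weight_bound[OF eps G eG CS S(1,3) r b]) auto
    also have "\<dots> = e x t * (K * (\<Phi> x t * (4 * r t + (real CARD('n) + 7) * \<beta>)))" by (simp add: mult_ac)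
    also have "\<dots> \<le> e x t * (K * (C * (2 * real CARD('n) + 16) / \<rho> ^ (CARD('n) + 1)))"
      using 4 K e_nonneg by (intro mult_left_mono) auto
    finally show ?thesis by (simp add: mult.assoc)
  qed
qed

lemma cylinder_V: "x \<in> cball x0 \<rho> \<Longrightarrow> t0 - \<rho>\<^sup>2 \<le> t \<Longrightarrow> t < t0 \<Longrightarrow> (x, t) \<in> V"
  using cyl by (auto simp: V_def)

lemma cylinder_cont:
  assumes "continuous_on V (\<lambda>y. f (fst y) (snd y))" "t0 - \<rho>\<^sup>2 \<le> s" "t < t0"
  shows "continuous_on (cball x0 \<rho> \<times> {s..t}) (case_prod f)"
  unfolding case_prod_unfold using assms(1)
  by (rule continuous_on_subset) (use assms cylinder_V in auto)

lemma E_nonneg: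
  assumes "(x, t) \<in> V" shows "0 \<le> E x t"
proof -
  have "0 \<le> h (S x / \<rho>\<^sup>2)" using cutoff by (simp add: is_cutoff_def)
  then show ?thesis
    using assms g_nonneg[of x t] Phi_pos[of t x] e_nonneg[of x t]
    by (auto simp: E_def \<psi>_def V_def intro!: mult_nonneg_nonneg)
qed

lemma integrable_E:
  assumes "t0 - \<rho>\<^sup>2 \<le> t" "t < t0"
  shows "integrable lborel (\<lambda>x. indicator (cball x0 \<rho>) x * E x t)"
    and "integrable lborel (\<lambda>x. indicator (cball x0 \<rho>) x * E' x t)"
    and "integrable lborel (\<lambda>x. indicator (cball x0 \<rho>) x * (g x t * e x t))"
proof -
  have *: "integrable lborel (\<lambda>x. indicator (cball x0 \<rho>) x * f x t)"
    if "continuous_on V (\<lambda>y. f (fst y) (snd y))" for f :: "real^'n \<Rightarrow> real \<Rightarrow> real"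
  proof -
    have "continuous_on (cball x0 \<rho>) (\<lambda>x. f (fst (x, t)) (snd (x, t)))"
      using assms cylinder_V
      by (intro continuous_on_compose2[OF that, of _ "\<lambda>x. (x, t)"] continuous_intros) auto
    then show ?thesis using borel_integrable_compact[of "cball x0 \<rho>" "\<lambda>x. f x t"] by simp
  qed
  show "integrable lborel (\<lambda>x. indicator (cball x0 \<rho>) x * E x t)"
    "integrable lborel (\<lambda>x. indicator (cball x0 \<rho>) x * E' x t)"
    by (intro * flux_cont)+
  show "integrable lborel (\<lambda>x. indicator (cball x0 \<rho>) x * (g x t * e x t))"
    by (rule *[of "\<lambda>x t. g x t * e x t"]) (intro continuous_intros)
qed

lemma integrable_ball:
  assumes "t0 - \<rho>\<^sup>2 \<le> t" "t < t0"
  shows "integrable lborel (\<lambda>x. indicator (ball x0 \<rho>) x * (g x t * e x t))"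
proof -
  have "set_integrable lborel (cball x0 \<rho>) (\<lambda>x. g x t * e x t)"
    using integrable_E(3)[OF assms] by (simp add: set_integrable_def)
  then have "set_integrable lborel (ball x0 \<rho>) (\<lambda>x. g x t * e x t)"
    by (rule set_integrable_subset) auto
  then show ?thesis by (simp add: set_integrable_def)
qed

section \<open>From the differential inequality to the averaged estimate, with a Gaussian constant
  valid at every scale\<close>

context
  fixes C :: real
  assumes C: "0 \<le> C" "\<And>\<tau> \<rho> S. \<tau> > 0 \<Longrightarrow> \<rho> > 0 \<Longrightarrow> S \<ge> \<rho>\<^sup>2 / 4 \<Longrightarrow>
    (4 * pi * \<tau>) powr (- real (CARD('n) - 1) / 2) * exp (- S / (4 * \<tau>)) \<le> C / \<rho> ^ (CARD('n) - 1) \<and>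
    (4 * pi * \<tau>) powr (- real (CARD('n) - 1) / 2) * exp (- S / (4 * \<tau>)) / \<tau> \<le> C / \<rho> ^ (CARD('n) - 1 + 2)"
begin

definition "L = K * C * (2 * real CARD('n) + 16) / \<rho> ^ (CARD('n) + 1)"

lemma K_nonneg: "0 \<le> K"
  using cutoff by (auto simp: is_cutoff_def intro: order_trans[OF abs_ge_zero])

lemma L_nonneg: "0 \<le> L"
  using K_nonneg C(1) rho by (simp add: L_def)

lemma flux_inequality:
  assumes "x \<in> ball x0 \<rho>" "t0 - \<rho>\<^sup>2 \<le> t" "t < t0"
  shows "E' x t + (\<Sum>j\<in>UNIV. Y' j x t) \<le> L * (g x t * e x t)"
proof -
  have V: "(x, t) \<in> V" using assms by (intro cylinder_V) auto
  then have a: "(x, t) \<in> U" by (simp add: V_def)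
  have "E' x t + (\<Sum>j\<in>UNIV. Y' j x t)
    = \<psi> x t * (e x t * (gt x t - (\<Sum>j\<in>UNIV. gxx j j x t)) + \<epsilon> * (\<Sum>i\<in>UNIV. \<Sum>j\<in>UNIV. sd i u x t * sd j u x t * gxx i j x t))
    + g x t * (e x t * (\<psi>t x t + (\<Sum>j\<in>UNIV. \<psi>xx j j x t)) - \<epsilon> * (\<Sum>i\<in>UNIV. \<Sum>j\<in>UNIV. sd i u x t * sd j u x t * \<psi>xx i j x t)
        - 2 * \<epsilon> * td u x t * (\<Sum>j\<in>UNIV. sd j u x t * \<psi>x j x t) - \<epsilon> * \<psi> x t * (td u x t)\<^sup>2)"
    unfolding E'_def Y'_def
    by (rule energy_flux_identity[where H="\<lambda>i j. sdd i j u x t" and w="W' (u x t)"])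
      (use eps hess_sym[OF a] eqn[OF a] in \<open>auto simp: X_def M_def\<close>)
  also have "\<dots> \<le> 0 + g x t * (e x t * L)"
  proof (rule add_mono)
    have "0 \<le> \<psi> x t"
      using cutoff Phi_pos[of t x] assms(3) by (simp add: \<psi>_def is_cutoff_def)
    then show "\<psi> x t * (e x t * (gt x t - (\<Sum>j\<in>UNIV. gxx j j x t))
        + \<epsilon> * (\<Sum>i\<in>UNIV. \<Sum>j\<in>UNIV. sd i u x t * sd j u x t * gxx i j x t)) \<le> 0"
      using g_sub[OF a] by (rule mult_nonneg_nonpos)
    show "g x t * (e x t * (\<psi>t x t + (\<Sum>j\<in>UNIV. \<psi>xx j j x t)) - \<epsilon> * (\<Sum>i\<in>UNIV. \<Sum>j\<in>UNIV. sd i u x t * sd j u x t * \<psi>xx i j x t)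
        - 2 * \<epsilon> * td u x t * (\<Sum>j\<in>UNIV. sd j u x t * \<psi>x j x t) - \<epsilon> * \<psi> x t * (td u x t)\<^sup>2) \<le> g x t * (e x t * L)"
      unfolding L_def using weight_inequality[OF C V assms(1)] g_nonneg[OF a] by (intro mult_left_mono)
  qed
  finally show ?thesis by (simp add: mult_ac)
qed

text \<open>The divergence of the flux integrates to 0, so it may be added before the integrands are
  compared pointwise. Off the open ball both sides are 0.\<close>

lemma energy_rate:
  assumes t: "t0 - \<rho>\<^sup>2 \<le> t" "t < t0"
  shows "(\<integral>x. indicator (cball x0 \<rho>) x * E' x t \<partial>lborel) \<le> L * (\<integral>x. indicator (ball x0 \<rho>) x * (g x t * e x t) \<partial>lborel)"
proof -
  have iY: "integrable lborel (\<lambda>x. \<Sum>j\<in>UNIV. indicator (cball x0 \<rho>) x * Y' j x t)"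
    by (intro Bochner_Integration.integrable_sum integral_divergence t)
  have "(\<integral>x. (\<Sum>j\<in>UNIV. indicator (cball x0 \<rho>) x * Y' j x t) \<partial>lborel) = 0"
    by (subst Bochner_Integration.integral_sum)
      (simp_all only: integral_divergence[OF t] sum.neutral_const)
  then have "(\<integral>x. indicator (cball x0 \<rho>) x * E' x t \<partial>lborel)
    = (\<integral>x. indicator (cball x0 \<rho>) x * E' x t + (\<Sum>j\<in>UNIV. indicator (cball x0 \<rho>) x * Y' j x t) \<partial>lborel)"
    by (subst Bochner_Integration.integral_add[OF integrable_E(2)[OF t] iY]) simp
  also have "\<dots> \<le> (\<integral>x. L * (indicator (ball x0 \<rho>) x * (g x t * e x t)) \<partial>lborel)"
  proof (rule integral_mono)
    show "integrable lborel (\<lambda>x. indicator (cball x0 \<rho>) x * E' x t + (\<Sum>j\<in>UNIV. indicator (cball x0 \<rho>) x * Y' j x t))"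
      using integrable_E(2)[OF t] iY by (rule Bochner_Integration.integrable_add)
    show "integrable lborel (\<lambda>x. L * (indicator (ball x0 \<rho>) x * (g x t * e x t)))"
      using integrable_ball[OF t] by simp
    show "indicator (cball x0 \<rho>) x * E' x t + (\<Sum>j\<in>UNIV. indicator (cball x0 \<rho>) x * Y' j x t)
      \<le> L * (indicator (ball x0 \<rho>) x * (g x t * e x t))" for x
    proof (cases "x \<in> ball x0 \<rho>")
      case True
      then show ?thesis using flux_inequality[OF True t] by simp
    next
      case False
      then have "\<rho> \<le> norm (x - x0)" by (simp add: dist_norm norm_minus_commute)
      then show ?thesis using False by (simp add: flux_outside)
    qed
  qed
  also have "\<dots> = L * (\<integral>x. indicator (ball x0 \<rho>) x * (g x t * e x t) \<partial>lborel)" by simp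
  finally show ?thesis .
qed

text \<open>The unweighted energy of \<open>g\<close> at one time and its space-time integral. Both
  are extended nonnegative integrals, so \<open>R\<close> makes sense even if \<open>J\<close> blows
  up towards \<open>t0\<close>.\<close>

definition "J t = (\<integral>\<^sup>+x. ennreal (g x t * e x t) * indicator (ball x0 \<rho>) x \<partial>lborel)"
definition "R = (\<integral>\<^sup>+\<tau>. J \<tau> * indicator {t0 - \<rho>\<^sup>2..<t0} \<tau> \<partial>lborel)"

text \<open>Enlarging the time interval from \<open>{s..t}\<close> to the full one makes the
  remainder independent of \<open>s\<close>, as the averaging over \<open>s\<close>
  requires.\<close>

lemma energy_increment:
  assumes "t0 - \<rho>\<^sup>2 \<le> s" "s \<le> t" "t < t0"
  shows "ennreal (\<integral>x. indicator (cball x0 \<rho>) x * E x t \<partial>lborel)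
    \<le> ennreal (\<integral>x. indicator (cball x0 \<rho>) x * E x s \<partial>lborel) + ennreal L * R"
proof -
  have "ennreal (\<integral>x. indicator (cball x0 \<rho>) x * E x t \<partial>lborel)
    \<le> ennreal (\<integral>x. indicator (cball x0 \<rho>) x * E x s \<partial>lborel)
      + ennreal L * (\<integral>\<^sup>+\<tau>. (\<integral>\<^sup>+x. ennreal (g x \<tau> * e x \<tau>) * indicator (ball x0 \<rho>) x \<partial>lborel) * indicator {s..t} \<tau> \<partial>lborel)"
  proof (rule integral_increment_le[where D=E'])
    show "(E x has_real_derivative E' x \<tau>) (at \<tau>)" if "x \<in> cball x0 \<rho>" "s \<le> \<tau>" "\<tau> \<le> t" for x \<tau>
      using that assms by (intro E_dt cylinder_V) auto
    show "continuous_on (cball x0 \<rho> \<times> {s..t}) (case_prod E)"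
      "continuous_on (cball x0 \<rho> \<times> {s..t}) (case_prod E')"
      using assms by (intro cylinder_cont flux_cont; simp)+
    show "continuous_on (cball x0 \<rho> \<times> {s..t}) (\<lambda>(x, \<tau>). g x \<tau> * e x \<tau>)"
      using assms by (intro cylinder_cont continuous_intros) auto
    show "0 \<le> g x \<tau> * e x \<tau>" if "x \<in> cball x0 \<rho>" "s \<le> \<tau>" "\<tau> \<le> t" for x \<tau>
      using that assms cyl by (intro mult_nonneg_nonneg g_nonneg e_nonneg) auto
    show "(\<integral>x. indicator (cball x0 \<rho>) x * E' x \<tau> \<partial>lborel) \<le> L * (\<integral>x. indicator (ball x0 \<rho>) x * (g x \<tau> * e x \<tau>) \<partial>lborel)"
      if "s \<le> \<tau>" "\<tau> \<le> t" for \<tau>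
      using that assms by (intro energy_rate) auto
  qed (use assms L_nonneg in auto)
  also have "\<dots> \<le> ennreal (\<integral>x. indicator (cball x0 \<rho>) x * E x s \<partial>lborel) + ennreal L * R"
    unfolding R_def J_def using assms
    by (intro add_left_mono mult_left_mono nn_integral_mono) (auto simp: indicator_def)
  finally show ?thesis .
qed

text \<open>At these times \<open>4 * pi * (t0 - s)\<close> is at least
  \<open>\<rho>\<^sup>2\<close>, and the exponent of the kernel is nonpositive; hence the kernel is
  bounded on the whole space, the singular point included.\<close>

lemma initial_energy:
  assumes s: "t0 - \<rho>\<^sup>2 \<le> s" "s \<le> t0 - \<rho>\<^sup>2 / 4"
  shows "ennreal (\<integral>x. indicator (cball x0 \<rho>) x * E x s \<partial>lborel) \<le> ennreal (1 / \<rho> ^ (CARD('n) - 1)) * J s"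
proof -
  let ?c = "1 / \<rho> ^ (CARD('n) - 1)"
  have st: "s < t0" using s zero_less_power[OF rho, of 2] by linarith
  have nn: "0 \<le> g x s * e x s" if "x \<in> cball x0 \<rho>" for x
    using cyl that s st by (intro mult_nonneg_nonneg g_nonneg e_nonneg) auto
  have \<Phi>: "\<Phi> x s \<le> ?c" for x
  proof -
    have "(4 * pi * (t0 - s)) powr (- real (CARD('n) - 1) / 2) \<le> (\<rho>\<^sup>2) powr (- real (CARD('n) - 1) / 2)"
    proof (rule powr_mono2')
      have "\<rho>\<^sup>2 \<le> 1 * (4 * (t0 - s))" using s by simp
      also have "\<dots> \<le> pi * (4 * (t0 - s))" using pi_gt3 st by (intro mult_right_mono) auto
      finally show "\<rho>\<^sup>2 \<le> 4 * pi * (t0 - s)" by (simp add: mult_ac)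
    qed (use rho in auto)
    also have "\<dots> = (\<rho> powr 2) powr (- real (CARD('n) - 1) / 2)"
      using rho by (simp add: powr_numeral)
    also have "\<dots> = \<rho> powr (- real (CARD('n) - 1))"
      unfolding powr_powr by (rule arg_cong[where f="(powr) \<rho>"]) (simp add: field_simps)
    also have "\<dots> = ?c" using rho unfolding powr_minus powr_realpow[OF rho] by (simp add: inverse_eq_divide)
    finally have "(4 * pi * (t0 - s)) powr (- real (CARD('n) - 1) / 2) * exp (- S x / (4 * (t0 - s))) \<le> ?c * 1"
      using st rho by (intro mult_mono) (auto simp: S_def)
    then show ?thesis unfolding Phi_eq by simp
  qed
  have "(\<integral>x. indicator (cball x0 \<rho>) x * E x s \<partial>lborel) \<le> (\<integral>x. ?c * (indicator (ball x0 \<rho>) x * (g x s * e x s)) \<partial>lborel)"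
  proof (rule integral_mono)
    show "indicator (cball x0 \<rho>) x * E x s \<le> ?c * (indicator (ball x0 \<rho>) x * (g x s * e x s))" for x
    proof (cases "x \<in> ball x0 \<rho>")
      case True
      have "0 \<le> h (S x / \<rho>\<^sup>2)" "h (S x / \<rho>\<^sup>2) \<le> 1" using cutoff by (simp_all add: is_cutoff_def)
      then have "\<psi> x s \<le> ?c * 1"
        unfolding \<psi>_def using \<Phi>[of x] Phi_pos[OF st, of x] rho by (intro mult_mono) auto
      then have "\<psi> x s * (g x s * e x s) \<le> ?c * (g x s * e x s)"
        using nn[of x] True by (intro mult_right_mono) auto
      then show ?thesis using True by (simp add: E_def mult_ac)
    next
      case False
      then have "\<rho> \<le> norm (x - x0)" by (simp add: dist_norm norm_minus_commute)
      then show ?thesis using False by (simp add: flux_outside)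
    qed
    show "integrable lborel (\<lambda>x. ?c * (indicator (ball x0 \<rho>) x * (g x s * e x s)))"
      using integrable_ball[OF s(1) st] by simp
  qed (rule integrable_E(1)[OF s(1) st])
  also have "\<dots> = ?c * (\<integral>x. indicator (ball x0 \<rho>) x * (g x s * e x s) \<partial>lborel)" by simp
  finally have "ennreal (\<integral>x. indicator (cball x0 \<rho>) x * E x s \<partial>lborel)
    \<le> ennreal ?c * ennreal (\<integral>x. indicator (ball x0 \<rho>) x * (g x s * e x s) \<partial>lborel)"
    using rho nn by (subst ennreal_mult[symmetric])
      (auto intro!: ennreal_leI integral_nonneg_AE AE_I2 simp: indicator_def)
  also have "ennreal (\<integral>x. indicator (ball x0 \<rho>) x * (g x s * e x s) \<partial>lborel) = J s"
    unfolding J_def using nn integrable_ball[OF s(1) st]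
    by (subst nn_integral_eq_integral[symmetric])
      (auto intro!: AE_I2 nn_integral_cong simp: indicator_def)
  finally show ?thesis .
qed

text \<open>Averaging over the starting time replaces a cutoff in time. Subtracting the constant before
  integrating avoids any measurability requirement on \<open>J\<close>.\<close>

lemma averaged_bound:
  assumes bnd: "\<And>s. t0 - \<rho>\<^sup>2 \<le> s \<Longrightarrow> s \<le> t0 - \<rho>\<^sup>2 / 4 \<Longrightarrow>
      I \<le> ennreal (1 / \<rho> ^ (CARD('n) - 1)) * J s + ennreal L * R"
    and I: "I \<noteq> top"
  shows "I \<le> ennreal (4 / 3 / \<rho> ^ (CARD('n) + 1) + L) * R"
proof -
  let ?a = "\<rho> ^ (CARD('n) - 1)"
  have a: "?a > 0" using rho by simp
  \<comment> \<open>A lower bound for \<open>J s\<close> that is the same for all early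
    \<open>s\<close>. Subtraction of \<open>ennreal\<close> truncates at 0, so an infinite
    \<open>R\<close> needs no separate case.\<close>
  define D where "D = ennreal ?a * (I - ennreal L * R)"
  have D: "D \<le> J s" if "t0 - \<rho>\<^sup>2 \<le> s" "s \<le> t0 - \<rho>\<^sup>2 / 4" for s
  proof -
    have "I - ennreal L * R \<le> ennreal (1 / ?a) * J s"
      using bnd[OF that] I by (simp add: ennreal_minus_le_iff add.commute)
    then have "D \<le> ennreal ?a * (ennreal (1 / ?a) * J s)"
      unfolding D_def by (rule mult_left_mono) simp
    also have "\<dots> = J s"
      using rho by (simp add: mult.assoc[symmetric] ennreal_mult[symmetric])
    finally show ?thesis .
  qed
  have "emeasure lborel {t0 - \<rho>\<^sup>2..t0 - \<rho>\<^sup>2 / 4} = ennreal (t0 - \<rho>\<^sup>2 / 4 - (t0 - \<rho>\<^sup>2))"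
    using zero_le_power2[of \<rho>] by (intro emeasure_lborel_Icc) linarith
  also have "t0 - \<rho>\<^sup>2 / 4 - (t0 - \<rho>\<^sup>2) = 3 / 4 * \<rho>\<^sup>2" by simp
  finally have "D * ennreal (3 / 4 * \<rho>\<^sup>2) = (\<integral>\<^sup>+\<tau>. D * indicator {t0 - \<rho>\<^sup>2..t0 - \<rho>\<^sup>2 / 4} \<tau> \<partial>lborel)"
    by (simp only: nn_integral_cmult_indicator[of _ lborel] sets_lborel atLeastAtMost_borel)
  also have "\<dots> \<le> R"
    unfolding R_def
  proof (rule nn_integral_mono)
    fix \<tau>
    show "D * indicator {t0 - \<rho>\<^sup>2..t0 - \<rho>\<^sup>2 / 4} \<tau> \<le> J \<tau> * indicator {t0 - \<rho>\<^sup>2..<t0} \<tau>"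
    proof (cases "\<tau> \<in> {t0 - \<rho>\<^sup>2..t0 - \<rho>\<^sup>2 / 4}")
      case True
      then have "\<tau> < t0" using zero_less_power[OF rho, of 2] unfolding atLeastAtMost_iff by linarith
      then show ?thesis using True D[of \<tau>] by simp
    qed simp
  qed
  finally have DR: "D * ennreal (3 / 4 * \<rho>\<^sup>2) \<le> R" .
  \<comment> \<open>The inverse of the length \<open>3 / 4 * \<rho>\<^sup>2\<close> of the averaging
    interval, times the kernel bound \<open>1 / \<rho> ^ (CARD('n) - 1)\<close>.\<close>
  define b where "b = 4 / 3 / \<rho> ^ (CARD('n) + 1)"
  have b: "0 \<le> b" using rho by (simp add: b_def)
  have "b * ?a * (3 / 4 * \<rho>\<^sup>2) = 1"
  proof -
    have N: "\<rho> ^ (CARD('n) + 1) = ?a * \<rho>\<^sup>2"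
      unfolding power_add[symmetric] by (rule arg_cong[where f="(^) \<rho>"]) (simp add: Suc_leI)
    show ?thesis using rho unfolding b_def N by (simp add: field_simps)
  qed
  then have "I - ennreal L * R = ennreal (b * ?a * (3 / 4 * \<rho>\<^sup>2)) * (I - ennreal L * R)"
    by simp
  also have "ennreal (b * ?a * (3 / 4 * \<rho>\<^sup>2)) = ennreal b * ennreal ?a * ennreal (3 / 4 * \<rho>\<^sup>2)"
    using b a by (subst ennreal_mult, simp, simp, subst ennreal_mult) auto
  also have "\<dots> * (I - ennreal L * R) = ennreal b * (D * ennreal (3 / 4 * \<rho>\<^sup>2))"
    unfolding D_def by (simp only: mult_ac)
  also have "\<dots> \<le> ennreal b * R"
    using DR by (rule mult_left_mono) simp
  finally have "I \<le> ennreal L * R + ennreal b * R"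
    by (simp only: ennreal_minus_le_iff)
  also have "\<dots> = ennreal (b + L) * R"
    using L_nonneg b by (simp only: ennreal_plus distrib_right add.commute)
  finally show ?thesis unfolding b_def .
qed

theorem local_energy_estimate:
  assumes t: "t0 - \<rho>\<^sup>2 / 4 \<le> t" "t < t0"
  shows "(\<integral>\<^sup>+x. ennreal (g x t * Phi (CARD('n) - 1) x0 t0 x t * edens \<epsilon> u x t) * indicator (ball x0 (\<rho> / 2)) x \<partial>lborel)
    \<le> ennreal ((4 / 3 + K * C * (2 * real CARD('n) + 16)) / \<rho> ^ (CARD('n) + 1)) *
      (\<integral>\<^sup>+\<tau>. (\<integral>\<^sup>+x. ennreal (g x \<tau> * edens \<epsilon> u x \<tau>) * indicator (ball x0 \<rho>) x \<partial>lborel)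
        * indicator {t0 - \<rho>\<^sup>2..<t0} \<tau> \<partial>lborel)"
proof -
  have t1: "t0 - \<rho>\<^sup>2 \<le> t" using t zero_le_power2[of \<rho>] by linarith
  have V: "(x, t) \<in> V" if "x \<in> cball x0 \<rho>" for x
    using that t1 t by (intro cylinder_V)
  have core: "E x t = g x t * \<Phi> x t * e x t" if "x \<in> ball x0 (\<rho> / 2)" for x
  proof -
    have "S x \<le> (\<rho> / 2)\<^sup>2"
      using that unfolding S_def by (intro power_mono) (auto simp: dist_norm norm_minus_commute)
    then have "S x / \<rho>\<^sup>2 \<le> 1 / 4" using rho by (simp add: field_simps power2_eq_square)
    then have "h (S x / \<rho>\<^sup>2) = 1" using cutoff by (simp add: is_cutoff_def)
    then show ?thesis by (simp add: E_def \<psi>_def)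
  qed
  have "(\<integral>\<^sup>+x. ennreal (g x t * \<Phi> x t * e x t) * indicator (ball x0 (\<rho> / 2)) x \<partial>lborel)
      \<le> (\<integral>\<^sup>+x. ennreal (indicator (cball x0 \<rho>) x * E x t) \<partial>lborel)"
    using rho by (intro nn_integral_mono) (auto simp: indicator_def core)
  also have "\<dots> = ennreal (\<integral>x. indicator (cball x0 \<rho>) x * E x t \<partial>lborel)"
    using E_nonneg V by (intro nn_integral_eq_integral integrable_E t1 t AE_I2) (auto simp: indicator_def)
  also have "\<dots> \<le> ennreal (4 / 3 / \<rho> ^ (CARD('n) + 1) + L) * R"
  \<comment> \<open>Every starting time \<open>s\<close> in the averaging interval precedes
    \<open>t\<close>, because that interval ends at \<open>t0 - \<rho>\<^sup>2 / 4\<close>.\<close>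
  proof (rule averaged_bound)
    fix s assume s: "t0 - \<rho>\<^sup>2 \<le> s" "s \<le> t0 - \<rho>\<^sup>2 / 4"
    show "ennreal (\<integral>x. indicator (cball x0 \<rho>) x * E x t \<partial>lborel)
      \<le> ennreal (1 / \<rho> ^ (CARD('n) - 1)) * J s + ennreal L * R"
      using energy_increment[of s t] initial_energy[OF s] s t
      by (meson add_right_mono order_trans)
  qed simp
  also have "4 / 3 / \<rho> ^ (CARD('n) + 1) + L = (4 / 3 + K * C * (2 * real CARD('n) + 16)) / \<rho> ^ (CARD('n) + 1)"
    by (simp add: L_def add_divide_distrib)
  finally show ?thesis unfolding \<Phi>_def R_def J_def .
qed

end

end

subsection \<open>Subsolutions\<close>

text \<open>Squaring turns a nonnegative subsolution into a subsolution because the energy density dominates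
  \<open>\<epsilon> |\<nabla>u|\<^sup>2\<close>, so that the coefficient matrix \<open>I - \<epsilon> \<nabla>u \<otimes> \<nabla>u / e\<close> is nonnegative.\<close>

lemma square_subsolution:
  fixes p fx :: "'n::finite \<Rightarrow> real" and fxx :: "'n \<Rightarrow> 'n \<Rightarrow> real"
  assumes e: "0 < e" "\<epsilon> * (\<Sum>i\<in>UNIV. (p i)\<^sup>2) \<le> e" and eps: "\<epsilon> > 0" and f: "0 \<le> f"
    and sub: "ft - (\<Sum>i\<in>UNIV. fxx i i) + (\<Sum>i\<in>UNIV. \<Sum>j\<in>UNIV. \<epsilon> * p i * p j / e * fxx i j) \<le> 0"
  shows "e * (2 * f * ft - (\<Sum>j\<in>UNIV. 2 * (fx j * fx j + f * fxx j j)))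
    + \<epsilon> * (\<Sum>i\<in>UNIV. \<Sum>j\<in>UNIV. p i * p j * (2 * (fx i * fx j + f * fxx i j))) \<le> 0"
proof -
  define T where "T = (\<Sum>i\<in>UNIV. fxx i i)"
  define Q where "Q = (\<Sum>i\<in>UNIV. \<Sum>j\<in>UNIV. p i * p j * fxx i j)"
  define F where "F = (\<Sum>i\<in>UNIV. (fx i)\<^sup>2)"
  define A where "A = (\<Sum>i\<in>UNIV. p i * fx i)"
  have "(\<Sum>i\<in>UNIV. \<Sum>j\<in>UNIV. \<epsilon> * p i * p j / e * fxx i j) = \<epsilon> / e * Q"
    by (simp add: Q_def sum_distrib_left mult_ac)
  then have "ft - T + \<epsilon> / e * Q \<le> 0" using sub by (simp add: T_def)
  then have "2 * f * e * (ft - T + \<epsilon> / e * Q) \<le> 0" using f e by (intro mult_nonneg_nonpos) auto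
  moreover have "2 * f * e * (ft - T + \<epsilon> / e * Q) = 2 * f * (e * (ft - T) + \<epsilon> * Q)"
    using e(1) by (simp add: field_simps)
  ultimately have 1: "2 * f * (e * (ft - T) + \<epsilon> * Q) \<le> 0" by (simp only:)
  have "A\<^sup>2 \<le> (\<Sum>i\<in>UNIV. (p i)\<^sup>2) * F"
    unfolding A_def F_def by (rule Cauchy_Schwarz_ineq_sum)
  then have "\<epsilon> * A\<^sup>2 \<le> \<epsilon> * ((\<Sum>i\<in>UNIV. (p i)\<^sup>2) * F)" using eps by (intro mult_left_mono) auto
  also have "\<dots> = \<epsilon> * (\<Sum>i\<in>UNIV. (p i)\<^sup>2) * F" by simp
  also have "\<dots> \<le> e * F" using e by (intro mult_right_mono) (auto simp: F_def sum_nonneg)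
  finally have 2: "\<epsilon> * A\<^sup>2 \<le> e * F" .
  have s1: "(\<Sum>j\<in>UNIV. 2 * (fx j * fx j + f * fxx j j)) = 2 * F + 2 * f * T"
    by (simp add: F_def T_def power2_eq_square sum.distrib sum_distrib_left algebra_simps)
  have s2: "(\<Sum>i\<in>UNIV. \<Sum>j\<in>UNIV. p i * p j * (2 * (fx i * fx j + f * fxx i j))) = 2 * A\<^sup>2 + 2 * f * Q"
  proof -
    have "(\<Sum>i\<in>UNIV. \<Sum>j\<in>UNIV. p i * p j * (2 * (fx i * fx j + f * fxx i j)))
      = (\<Sum>i\<in>UNIV. \<Sum>j\<in>UNIV. 2 * ((p i * fx i) * (p j * fx j)) + 2 * f * (p i * p j * fxx i j))"
      by (intro sum.cong refl) (simp add: algebra_simps)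
    also have "\<dots> = 2 * (A * A) + 2 * f * Q"
      by (simp add: sum.distrib sum_distrib_left[symmetric] sum_distrib_right[symmetric] A_def Q_def)
    finally show ?thesis by (simp add: power2_eq_square)
  qed
  show ?thesis unfolding s1 s2 using 1 2 by (simp add: algebra_simps)
qed

text \<open>The ambient dimension \<open>CARD('n)\<close> is n + 1, so \<open>CARD('n) - 1\<close>
  is the kernel parameter n and the power \<open>CARD('n) + 1\<close> is n + 2. An arbitrary index
  \<open>k\<close> plays the part of the last coordinate.\<close>

theorem mainTheorem6:
  "\<exists>c::real.
    (\<forall>(\<epsilon>::real) (x0::real^'n::finite) (t0::real) (\<rho>::real) U u f.
      \<epsilon> > 0 \<longrightarrow> \<rho> > 0 \<longrightarrow>
      cball x0 \<rho> \<times> {t0 - \<rho>\<^sup>2..<t0} \<subseteq> U \<longrightarrow>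
      AC_sol \<epsilon> U u \<longrightarrow>
      smooth_on U (\<lambda>(x, t). f x t) \<longrightarrow>
      (\<forall>(x, t)\<in>U. f x t \<ge> 0 \<and>
         td f x t - lap f x t
         + (\<Sum>i\<in>UNIV. \<Sum>j\<in>UNIV. \<epsilon> * sd i u x t * sd j u x t / edens \<epsilon> u x t * sdd i j f x t) \<le> 0) \<longrightarrow>
      (\<forall>t\<in>{t0 - \<rho>\<^sup>2/4..<t0}.
         (\<integral>\<^sup>+x. ennreal ((f x t)\<^sup>2 * Phi (CARD('n) - 1) x0 t0 x t * edens \<epsilon> u x t)
                 * indicator (ball x0 (\<rho>/2)) x \<partial>lborel)
         \<le> ennreal (c / \<rho> ^ (CARD('n) + 1)) *
           (\<integral>\<^sup>+\<tau>. (\<integral>\<^sup>+x. ennreal ((f x \<tau>)\<^sup>2 * edens \<epsilon> u x \<tau>) * indicator (ball x0 \<rho>) x \<partial>lborel)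
                   * indicator {t0 - \<rho>\<^sup>2..<t0} \<tau> \<partial>lborel))) \<and>
    (\<forall>(\<epsilon>::real) (r::real) (U::((real^'n) \<times> real) set) u (k::'n).
      \<epsilon> > 0 \<longrightarrow> r > 0 \<longrightarrow>
      cball 0 r \<times> {- r\<^sup>2..<0} \<subseteq> U \<longrightarrow>
      AC_sol \<epsilon> U u \<longrightarrow>
      (\<forall>t\<in>{- r\<^sup>2/4..<0}.
         (\<integral>\<^sup>+x. ennreal ((x $ k)\<^sup>2 * Phi (CARD('n) - 1) 0 0 x t * edens \<epsilon> u x t)
                 * indicator (ball 0 (r/2)) x \<partial>lborel)
         \<le> ennreal (c / r ^ (CARD('n) + 1)) *
           (\<integral>\<^sup>+\<tau>. (\<integral>\<^sup>+x. ennreal ((x $ k)\<^sup>2 * edens \<epsilon> u x \<tau>) * indicator (ball 0 r) x \<partial>lborel)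
                   * indicator {- r\<^sup>2..<0} \<tau> \<partial>lborel)))"
proof -
  obtain C where C: "0 \<le> C" "\<And>\<tau> \<rho> S. \<tau> > 0 \<Longrightarrow> \<rho> > 0 \<Longrightarrow> S \<ge> \<rho>\<^sup>2 / 4 \<Longrightarrow>
    (4 * pi * \<tau>) powr (- real (CARD('n) - 1) / 2) * exp (- S / (4 * \<tau>)) \<le> C / \<rho> ^ (CARD('n) - 1) \<and>
    (4 * pi * \<tau>) powr (- real (CARD('n) - 1) / 2) * exp (- S / (4 * \<tau>)) / \<tau> \<le> C / \<rho> ^ (CARD('n) - 1 + 2)"
    using gaussian_annulus_bound[of "CARD('n) - 1"] by blast
  obtain h h1 h2 where cutoff: "is_cutoff 144 h h1 h2"
    using cutoff_exists by blast
  \<comment> \<open>Fixed before the solution, the radius and the base point, so it depends on the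
    dimension only: 4/3 comes from the averaging, 144 from the cutoff, \<open>C\<close> from the
    Gaussian.\<close>
  let ?c = "4 / 3 + 144 * C * (2 * real CARD('n) + 16)"
  show ?thesis
  proof (intro exI[of _ ?c] conjI allI impI ballI)
    fix \<epsilon> :: real and x0 :: "real^'n" and t0 \<rho> t :: real and U and u f :: "real^'n \<Rightarrow> real \<Rightarrow> real"
    assume eps: "\<epsilon> > 0" and rho: "\<rho> > 0" and cyl: "cball x0 \<rho> \<times> {t0 - \<rho>\<^sup>2..<t0} \<subseteq> U" and AC: "AC_sol \<epsilon> U u"
      and f: "smooth_on U (\<lambda>(x, t). f x t)"
      and sub: "\<forall>(x, t)\<in>U. f x t \<ge> 0 \<and> td f x t - lap f x t
         + (\<Sum>i\<in>UNIV. \<Sum>j\<in>UNIV. \<epsilon> * sd i u x t * sd j u x t / edens \<epsilon> u x t * sdd i j f x t) \<le> 0"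
      and t: "t \<in> {t0 - \<rho>\<^sup>2/4..<t0}"
    interpret weighted_energy \<epsilon> x0 t0 \<rho> U u "\<lambda>x t. (f x t)\<^sup>2" "\<lambda>x t. 2 * f x t * td f x t"
      "\<lambda>j x t. 2 * (f x t * sd j f x t)" "\<lambda>j i x t. 2 * (sd j f x t * sd i f x t + f x t * sdd j i f x t)"
      144 h h1 h2
    proof
      fix x t assume a: "(x, t) \<in> U"
      note d = smooth_partials[OF f a]
      show "((\<lambda>s. (f (x + s *\<^sub>R axis j 1) t)\<^sup>2) has_real_derivative 2 * (f x t * sd j f x t)) (at 0)" for j
        using DERIV_power[OF d(1)[of j], of 2] by (simp add: mult_ac)
      show "((\<lambda>s. 2 * (f (x + s *\<^sub>R axis j 1) t * sd i f (x + s *\<^sub>R axis j 1) t)) has_real_derivative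
        2 * (sd j f x t * sd i f x t + f x t * sdd j i f x t)) (at 0)" for i j
        using DERIV_cmult[OF DERIV_mult[OF d(1)[of j] d(2)[of i j]], of 2] by (simp add: mult_ac)
      show "((\<lambda>t. (f x t)\<^sup>2) has_real_derivative 2 * f x t * td f x t) (at t)"
        using DERIV_power[OF d(3), of 2] by (simp add: mult_ac)
      show "edens \<epsilon> u x t * (2 * f x t * td f x t - (\<Sum>j\<in>UNIV. 2 * (sd j f x t * sd j f x t + f x t * sdd j j f x t)))
        + \<epsilon> * (\<Sum>i\<in>UNIV. \<Sum>j\<in>UNIV. sd i u x t * sd j u x t * (2 * (sd i f x t * sd j f x t + f x t * sdd i j f x t))) \<le> 0"
        using sub a by (intro square_subsolution AC_sol_energy[OF AC eps a] eps) (auto simp: lap_def)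
    next
      note c = smooth_partials_continuous[OF f]
      show "continuous_on U (\<lambda>z. (f (fst z) (snd z))\<^sup>2)"
        "continuous_on U (\<lambda>z. 2 * (f (fst z) (snd z) * sd i f (fst z) (snd z)))"
        "continuous_on U (\<lambda>z. 2 * (sd i f (fst z) (snd z) * sd j f (fst z) (snd z) + f (fst z) (snd z) * sdd i j f (fst z) (snd z)))"
        "continuous_on U (\<lambda>z. 2 * f (fst z) (snd z) * td f (fst z) (snd z))" for i j
        by (intro continuous_intros c)+
    qed (use eps rho cyl AC cutoff in auto)
    show "(\<integral>\<^sup>+x. ennreal ((f x t)\<^sup>2 * Phi (CARD('n) - 1) x0 t0 x t * edens \<epsilon> u x t)
                 * indicator (ball x0 (\<rho>/2)) x \<partial>lborel)
         \<le> ennreal (?c / \<rho> ^ (CARD('n) + 1)) *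
           (\<integral>\<^sup>+\<tau>. (\<integral>\<^sup>+x. ennreal ((f x \<tau>)\<^sup>2 * edens \<epsilon> u x \<tau>) * indicator (ball x0 \<rho>) x \<partial>lborel)
                   * indicator {t0 - \<rho>\<^sup>2..<t0} \<tau> \<partial>lborel)"
      using t by (intro local_energy_estimate[OF C]) auto
  next
    fix \<epsilon> r t :: real and U and u :: "real^'n \<Rightarrow> real \<Rightarrow> real" and k :: 'n
    assume eps: "\<epsilon> > 0" and r: "r > 0" and cyl: "cball 0 r \<times> {- r\<^sup>2..<0} \<subseteq> U" and AC: "AC_sol \<epsilon> U u"
      and t: "t \<in> {- r\<^sup>2/4..<0}"
    \<comment> \<open>Not an instance of the first part, because a coordinate changes sign and f was
      assumed nonnegative. The square of the coordinate is a subsolution directly: the expression is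
      \<open>- 2 * edens \<epsilon> u x t + 2 * \<epsilon> * (sd k u x t)\<^sup>2\<close>,
      nonpositive by the discrepancy bound.\<close>
    interpret weighted_energy \<epsilon> 0 0 r U u "\<lambda>x t. (x $ k)\<^sup>2" "\<lambda>x t. 0"
      "\<lambda>j x t. 2 * (x $ k * of_bool (j = k))" "\<lambda>j i x t. 2 * (of_bool (j = k) * of_bool (i = k))"
      144 h h1 h2
    proof
      fix x t assume a: "(x, t) \<in> U"
      have d: "((\<lambda>s. (x + s *\<^sub>R axis j 1) $ k) has_real_derivative of_bool (j = k)) (at 0)" for j
        by (auto simp: axis_def intro!: derivative_eq_intros)
      show "((\<lambda>s. ((x + s *\<^sub>R axis j 1) $ k)\<^sup>2) has_real_derivative 2 * (x $ k * of_bool (j = k))) (at 0)" for j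
        using DERIV_power[OF d[of j], of 2] by (simp add: mult_ac)
      show "((\<lambda>s. 2 * ((x + s *\<^sub>R axis j 1) $ k * of_bool (i = k))) has_real_derivative
        2 * (of_bool (j = k) * of_bool (i = k))) (at 0)" for i j
        using DERIV_cmult[OF DERIV_cmult_right[OF d[of j]], of 2] by simp
      have "(\<Sum>i\<in>UNIV. \<Sum>j\<in>UNIV. sd i u x t * sd j u x t * (2 * (of_bool (i = k) * of_bool (j = k)))) = 2 * (sd k u x t)\<^sup>2"
        by (simp add: of_bool_def if_distrib[of "(*) _"] if_distrib[of "\<lambda>y. y * _"] power2_eq_square cong: if_cong)
      moreover have "(sd k u x t)\<^sup>2 \<le> (\<Sum>i\<in>UNIV. (sd i u x t)\<^sup>2)"
        by (rule member_le_sum) auto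
      then have "\<epsilon> * (sd k u x t)\<^sup>2 \<le> edens \<epsilon> u x t"
        using AC_sol_energy(2)[OF AC eps a] eps by (meson less_imp_le mult_left_mono order_trans)
      ultimately show "edens \<epsilon> u x t * (0 - (\<Sum>j\<in>UNIV. 2 * (of_bool (j = k) * of_bool (j = k))))
        + \<epsilon> * (\<Sum>i\<in>UNIV. \<Sum>j\<in>UNIV. sd i u x t * sd j u x t * (2 * (of_bool (i = k) * of_bool (j = k)))) \<le> 0"
        by (simp add: of_bool_def if_distrib[of "(*) _"] cong: if_cong)
    next
      show "continuous_on U (\<lambda>z. (fst z $ k)\<^sup>2)"
        "continuous_on U (\<lambda>z. 2 * (fst z $ k * of_bool (i = k)))" for i
        by (intro continuous_intros)+
    qed (use eps r cyl AC cutoff in auto)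
    show "(\<integral>\<^sup>+x. ennreal ((x $ k)\<^sup>2 * Phi (CARD('n) - 1) 0 0 x t * edens \<epsilon> u x t)
                 * indicator (ball 0 (r/2)) x \<partial>lborel)
         \<le> ennreal (?c / r ^ (CARD('n) + 1)) *
           (\<integral>\<^sup>+\<tau>. (\<integral>\<^sup>+x. ennreal ((x $ k)\<^sup>2 * edens \<epsilon> u x \<tau>) * indicator (ball 0 r) x \<partial>lborel)
                   * indicator {- r\<^sup>2..<0} \<tau> \<partial>lborel)"
      using local_energy_estimate[OF C, of t] t by simp
  qed
qed

end
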